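(* A Sturmian morphism different from $E$ and $Id$ is weakly quasiperiodic if and only if it belongs to the set $$\{E,Id\}\{L_a,R_b\}^*\{L_a, R_a\}^* \cup \{E,Id\}\{L_b,R_a\}^*\{L_b, R_b\}^*.$$
   Context: The morphisms on $\{a,b\}^*$ (extended letterwise to infinite words) are: $E: a\mapsto b,\ b\mapsto a$; $L_a: a\mapsto a,\ b\mapsto ab$; $L_b: a\mapsto ba,\ b\mapsto b$; $R_a: a\mapsto a,\ b\mapsto ba$; $R_b: a\mapsto ab,\ b\mapsto b$; $Id$ is the identity. Juxtaposition denotes composition, $X^*$ is the set of all finite compositions of elements of $X$ (including $Id$), and for sets of morphisms $XY=\{fg: f\in X, g\in Y\}$. The Sturmian morphisms (the morphisms mapping every Sturmian word to a Sturmian word, where a Sturmian word is an infinite balanced non-ultimately-periodic word over $\{a,b\}$) are exactly the elements of $\{E,L_a,L_b,R_a,R_b\}^*$, by a theorem of Séébold. An infinite (i.e. right-infinite) word $w$ is quasiperiodic if there exist a finite word $u$ and finite words $(p_n)_{n\ge 0}$ with $p_0=\varepsilon$ such that, for all $n\ge 0$, $0<|p_{n+1}|-|p_n|\le |u|$ and $p_nu$ is a prefix of $w$. A morphism $f$ on $\{a,b\}$ is weakly quasiperiodic if there exist two non-quasiperiodic infinite words $w,w'$ over $\{a,b\}$ such that $f(w)$ is quasiperiodic and $f(w')$ is non-quasiperiodic. *)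

theory Defs
  imports Main "HOL-Library.Stream"
begin

datatype letter = ltr_a | ltr_b

type_synonym word = "letter list"
type_synonym infword = "letter stream"

definition prefix_of_inf :: "word \<Rightarrow> infword \<Rightarrow> bool" where
  "prefix_of_inf u w \<longleftrightarrow> stake (length u) w = u"

definition factor_of_inf :: "word \<Rightarrow> infword \<Rightarrow> bool" where
  "factor_of_inf u w \<longleftrightarrow> (\<exists>n. prefix_of_inf u (sdrop n w))"

definition balanced :: "infword \<Rightarrow> bool" where
  "balanced w \<longleftrightarrow>
     (\<forall>u v. factor_of_inf u w \<and> factor_of_inf v w \<and> length u = length v
        \<longrightarrow> \<bar>int (count_list u ltr_a) - int (count_list v ltr_a)\<bar> \<le> 1)"

definition ultimately_periodic :: "infword \<Rightarrow> bool" where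
  "ultimately_periodic w \<longleftrightarrow> (\<exists>u v. v \<noteq> [] \<and> w = u @- cycle v)"

definition sturmian :: "infword \<Rightarrow> bool" where
  "sturmian w \<longleftrightarrow> balanced w \<and> \<not> ultimately_periodic w"

definition quasiperiodic :: "infword \<Rightarrow> bool" where
  "quasiperiodic w \<longleftrightarrow>
     (\<exists>(u :: word) (p :: nat \<Rightarrow> word).
        p 0 = [] \<and>
        (\<forall>n. length (p n) < length (p (Suc n)) \<and>
             length (p (Suc n)) \<le> length (p n) + length u \<and>
             prefix_of_inf (p n @ u) w))"

definition morphism :: "(word \<Rightarrow> word) \<Rightarrow> bool" where
  "morphism f \<longleftrightarrow> (\<forall>u v. f (u @ v) = f u @ f v)"

text \<open>The letterwise extension of a morphism \<open>f\<close> to infinite words, as a relation: \<open>v\<close> is the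
  infinite word \<open>f(w)\<close>.  It is single-valued; if \<open>f\<close> erases letters, \<open>f(w)\<close> may be finite, and then
  no \<open>v\<close> is related to \<open>w\<close>.\<close>
definition inf_image :: "(word \<Rightarrow> word) \<Rightarrow> infword \<Rightarrow> infword \<Rightarrow> bool" where
  "inf_image f w v \<longleftrightarrow>
     (\<forall>n. prefix_of_inf (f (stake n w)) v) \<and> (\<forall>N. \<exists>n. N \<le> length (f (stake n w)))"

definition sturmian_morphism :: "(word \<Rightarrow> word) \<Rightarrow> bool" where
  "sturmian_morphism f \<longleftrightarrow>
     morphism f \<and> (\<forall>w. sturmian w \<longrightarrow> (\<exists>v. inf_image f w v \<and> sturmian v))"

definition weakly_quasiperiodic :: "(word \<Rightarrow> word) \<Rightarrow> bool" where
  "weakly_quasiperiodic f \<longleftrightarrow>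
     morphism f \<and>
     (\<exists>w w'. \<not> quasiperiodic w \<and> \<not> quasiperiodic w' \<and>
        (\<exists>v. inf_image f w v \<and> quasiperiodic v) \<and>
        (\<exists>v'. inf_image f w' v' \<and> \<not> quasiperiodic v'))"

definition morph_of :: "word \<Rightarrow> word \<Rightarrow> word \<Rightarrow> word" where
  "morph_of x y u = concat (map (\<lambda>c. case c of ltr_a \<Rightarrow> x | ltr_b \<Rightarrow> y) u)"

definition mor_E :: "word \<Rightarrow> word" where "mor_E = morph_of [ltr_b] [ltr_a]"
definition mor_La :: "word \<Rightarrow> word" where "mor_La = morph_of [ltr_a] [ltr_a, ltr_b]"
definition mor_Lb :: "word \<Rightarrow> word" where "mor_Lb = morph_of [ltr_b, ltr_a] [ltr_b]"
definition mor_Ra :: "word \<Rightarrow> word" where "mor_Ra = morph_of [ltr_a] [ltr_b, ltr_a]"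
definition mor_Rb :: "word \<Rightarrow> word" where "mor_Rb = morph_of [ltr_a, ltr_b] [ltr_b]"

inductive_set comp_star :: "(word \<Rightarrow> word) set \<Rightarrow> (word \<Rightarrow> word) set"
  for X :: "(word \<Rightarrow> word) set" where
  comp_star_id: "id \<in> comp_star X"
| comp_star_step: "f \<in> X \<Longrightarrow> g \<in> comp_star X \<Longrightarrow> f \<circ> g \<in> comp_star X"

definition comp_set :: "(word \<Rightarrow> word) set \<Rightarrow> (word \<Rightarrow> word) set \<Rightarrow> (word \<Rightarrow> word) set"
    (infixl "\<odot>" 70) where
  "X \<odot> Y = {f \<circ> g | f g. f \<in> X \<and> g \<in> Y}"

end

(*
  Say that f is strongly quasiperiodic if it maps every infinite word to a quasiperiodic one.  The
  identities b R_b(x) = L_b(x) and a R_a(x) = L_a(x) reduce all quasiperiodicity to the single fact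
  that L_a L_b(x) is always covered by aba.  From it, a product of generators that lies in neither
  {L_a,R_b}*{L_a,R_a}* nor {L_b,R_a}*{L_b,R_b}* is strongly quasiperiodic, hence not weakly
  quasiperiodic.

  Conversely, L_a and R_b preserve infinite Lyndon words (a < b), which are not quasiperiodic, and an
  element of {L_a,R_a}* yields a Lyndon word on a^m b b b ... for large m; so products of the first
  kind map some non-quasiperiodic word to a non-quasiperiodic one.  Their rightmost factor already
  maps some non-quasiperiodic word to a quasiperiodic one.  Exchanging letters gives the second kind.

  That Sturmian morphisms are products of generators (Seebold) is shown by descent on
  |f(a)| + |f(b)|.  A balanced word does not contain both aa and bb.  If bb does not occur in the
  images f(u), |u| = 2, all images start with a or all end with a, so f = L_a g or f = R_a g.  In the
  mixed cases f(a) and f(b) alternate, and balance forces f = Id or f = E.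
*)
theory Submission
  imports Defs "HOL-Library.Sublist" "HOL-Analysis.Continuum_Not_Denumerable"
begin

section \<open>Letterwise extension to infinite words\<close>

text \<open>R_a R_b is known to give a quasiperiodic word only on words that start with a, and L_a
  R_b only on words that start with b; hence the classification has to follow first letters through
  a product. Since L_a, R_a commute, and likewise L_b, R_b, a generator put in front of a product of
  the first kind moves inwards until it is absorbed or completes L_b L_a, L_a R_a R_b or L_b R_b
  R_a, each of which makes every word quasiperiodic.

  The obstacle in the descent is that an infinite word has no left context, so balance of R_a(y)
  says too little about the beginning of y. Therefore f is tested only on a set of Sturmian words in
  which each can be extended to the left. This set consists of the mechanical words of one
  irrational slope and their images under E. The slope lies between 1/5 and 1/4 so that a word of
  the set begins with aaaaba; the images of its factors aaa and aba control f(a) and f(b) in the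
  mixed cases.\<close>

lemma forall_letter: "(\<forall>c. P c) \<longleftrightarrow> P ltr_a \<and> P ltr_b"
  by (metis letter.exhaust)

lemma stream_eqI: "(\<And>n. s !! n = t !! n) \<Longrightarrow> s = t"
  using smap_alt[of id s t] by (simp add: stream.map_id)

lemma stream_eq_stakeI: "(\<And>n. stake n s = stake n t) \<Longrightarrow> s = t"
  by (metis stream_eqI lessI stake_nth)

lemma prefix_of_inf_iff: "prefix_of_inf u w \<longleftrightarrow> (\<exists>v. w = u @- v)"
proof
  assume "prefix_of_inf u w"
  then show "\<exists>v. w = u @- v" by (metis prefix_of_inf_def stake_sdrop)
qed (auto simp: prefix_of_inf_def stake_shift)

lemma shift_eq_stake: "w = u @- v \<Longrightarrow> n \<le> length u \<Longrightarrow> stake n w = take n u"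
  by (simp add: stake_shift)

lemma morphism_Nil: "morphism f \<Longrightarrow> f [] = []"
  by (metis append_is_Nil_conv append_self_conv morphism_def)

lemma morphism_Cons: "morphism f \<Longrightarrow> f (c # u) = f [c] @ f u"
  by (metis append_Cons append_Nil morphism_def)

lemma morphism_append: "morphism f \<Longrightarrow> f (u @ v) = f u @ f v"
  by (simp add: morphism_def)

lemma morphism_eqI:
  assumes "morphism f" "morphism g" "f [ltr_a] = g [ltr_a]" "f [ltr_b] = g [ltr_b]"
  shows "f = g"
proof
  have "f [c] = g [c]" for c using assms by (cases c) auto
  then show "f u = g u" for u
    by (induction u) (metis assms(1,2) morphism_Nil, metis assms(1,2) morphism_Cons)
qed

lemma morphism_morph_of [simp]: "morphism (morph_of x y)"
  by (simp add: morphism_def morph_of_def)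

lemma morph_of_letter [simp]: "morph_of x y [ltr_a] = x" "morph_of x y [ltr_b] = y"
  by (simp_all add: morph_of_def)

definition nonerasing :: "(word \<Rightarrow> word) \<Rightarrow> bool" where
  "nonerasing f \<longleftrightarrow> morphism f \<and> (\<forall>c. f [c] \<noteq> [])"

text \<open>\<open>flat\<close> concatenates correctly only when no block is empty, so
  \<open>ext\<close> is meant for \<open>nonerasing\<close> morphisms; there it turns the relation
  \<open>inf_image\<close> into a function.\<close>

definition ext :: "(word \<Rightarrow> word) \<Rightarrow> infword \<Rightarrow> infword" where
  "ext f w = flat (smap (\<lambda>c. f [c]) w)"

lemma nonerasing_morphism: "nonerasing f \<Longrightarrow> morphism f"
  by (simp add: nonerasing_def)

lemma nonerasing_id [simp]: "nonerasing id"
  by (simp add: nonerasing_def morphism_def)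

lemma nonerasing_length: "nonerasing f \<Longrightarrow> length u \<le> length (f u)"
proof (induction u)
  case (Cons c u)
  have "f (c # u) = f [c] @ f u" using Cons.prems morphism_Cons unfolding nonerasing_def by blast
  moreover have "length (f [c]) \<ge> 1" using Cons.prems by (simp add: nonerasing_def Suc_leI)
  ultimately show ?case using Cons by simp
qed simp

lemma nonerasing_comp: "nonerasing f \<Longrightarrow> nonerasing g \<Longrightarrow> nonerasing (f \<circ> g)"
  unfolding nonerasing_def
proof (intro conjI allI)
  assume f: "morphism f \<and> (\<forall>c. f [c] \<noteq> [])" and g: "morphism g \<and> (\<forall>c. g [c] \<noteq> [])"
  then show "morphism (f \<circ> g)" by (simp add: morphism_def)
  fix c
  have "length (g [c]) \<le> length (f (g [c]))"
    using nonerasing_length[of f] f by (simp add: nonerasing_def)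
  then show "(f \<circ> g) [c] \<noteq> []" using g by (metis comp_apply le_zero_eq length_0_conv)
qed

lemma ext_SCons: "nonerasing f \<Longrightarrow> ext f (c ## w) = f [c] @- ext f w"
  by (simp add: ext_def nonerasing_def)

lemma ext_shift: "nonerasing f \<Longrightarrow> ext f (u @- w) = f u @- ext f w"
proof (induction u)
  case Nil then show ?case by (simp add: nonerasing_def morphism_Nil)
next
  case (Cons c u)
  then have "f (c # u) = f [c] @ f u" using morphism_Cons unfolding nonerasing_def by blast
  with Cons show ?case by (simp add: ext_SCons)
qed

lemma ext_split: "nonerasing f \<Longrightarrow> ext f w = f (stake n w) @- ext f (sdrop n w)"
  by (metis ext_shift stake_sdrop)

lemma shd_ext: "nonerasing f \<Longrightarrow> shd (ext f w) = hd (f [shd w])"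
  by (metis ext_SCons nonerasing_def shift_simps(1) stream.collapse)

lemma inf_image_ext:
  assumes "nonerasing f"
  shows "inf_image f w v \<longleftrightarrow> v = ext f w"
proof
  assume v: "inf_image f w v"
  show "v = ext f w"
  proof (rule stream_eq_stakeI)
    fix n
    have l: "n \<le> length (f (stake n w))" using nonerasing_length[OF assms, of "stake n w"] by simp
    have "prefix_of_inf (f (stake n w)) v" using v by (simp add: inf_image_def)
    then obtain t where t: "v = f (stake n w) @- t" by (auto simp: prefix_of_inf_iff)
    show "stake n v = stake n (ext f w)"
      using shift_eq_stake[OF t l] shift_eq_stake[OF ext_split[OF assms] l] by simp
  qed
next
  assume "v = ext f w"
  then show "inf_image f w v"
    unfolding inf_image_def prefix_of_inf_iff
    by (metis assms ext_split length_stake nonerasing_length)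
qed

text \<open>\<open>inf_image\<close> determines its result, so it is enough that the images of
  prefixes of \<open>w\<close> under the composite are arbitrarily long prefixes of
  \<open>ext f (ext g w)\<close>; no coinduction enters.\<close>

lemma ext_comp:
  assumes "nonerasing f" "nonerasing g"
  shows "ext (f \<circ> g) w = ext f (ext g w)"
proof -
  have "inf_image (f \<circ> g) w (ext f (ext g w))"
    unfolding inf_image_def prefix_of_inf_iff
  proof (intro conjI allI)
    fix n
    have "ext f (ext g w) = ext f (g (stake n w) @- ext g (sdrop n w))"
      using ext_split[OF assms(2)] by metis
    then show "\<exists>v. ext f (ext g w) = (f \<circ> g) (stake n w) @- v"
      using ext_shift[OF assms(1)] by auto
    show "\<exists>k. n \<le> length ((f \<circ> g) (stake k w))"
      by (metis length_stake nonerasing_length nonerasing_comp assms)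
  qed
  then show ?thesis using inf_image_ext nonerasing_comp assms by metis
qed

lemma ext_id [simp]: "ext id w = w"
proof -
  have "inf_image id w w"
    by (auto simp: inf_image_def prefix_of_inf_def intro: exI[of _ "_::nat"])
  then show ?thesis using inf_image_ext[of id] by simp
qed

section \<open>The generators\<close>

lemma generator_letter [simp]:
  "mor_E [ltr_a] = [ltr_b]" "mor_E [ltr_b] = [ltr_a]"
  "mor_La [ltr_a] = [ltr_a]" "mor_La [ltr_b] = [ltr_a, ltr_b]"
  "mor_Lb [ltr_a] = [ltr_b, ltr_a]" "mor_Lb [ltr_b] = [ltr_b]"
  "mor_Ra [ltr_a] = [ltr_a]" "mor_Ra [ltr_b] = [ltr_b, ltr_a]"
  "mor_Rb [ltr_a] = [ltr_a, ltr_b]" "mor_Rb [ltr_b] = [ltr_b]"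
  by (simp_all add: mor_E_def mor_La_def mor_Lb_def mor_Ra_def mor_Rb_def)

lemma nonerasing_generator [simp]:
  "nonerasing mor_E" "nonerasing mor_La" "nonerasing mor_Lb" "nonerasing mor_Ra" "nonerasing mor_Rb"
  unfolding nonerasing_def forall_letter
  by (simp_all) (simp_all add: mor_E_def mor_La_def mor_Lb_def mor_Ra_def mor_Rb_def)

lemmas morphism_generator [simp] = nonerasing_generator[THEN nonerasing_morphism]

lemma generator_Nil [simp]:
  "mor_E [] = []" "mor_La [] = []" "mor_Lb [] = []" "mor_Ra [] = []" "mor_Rb [] = []"
  by (simp_all add: morphism_Nil)

text \<open>Without the guard, a rule would rewrite the image of a one-letter word to itself
  followed by the image of \<open>[]\<close>, and loop.\<close>

lemma generator_Cons:
  "NO_MATCH [] u \<Longrightarrow> mor_E (c # u) = mor_E [c] @ mor_E u"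
  "NO_MATCH [] u \<Longrightarrow> mor_La (c # u) = mor_La [c] @ mor_La u"
  "NO_MATCH [] u \<Longrightarrow> mor_Lb (c # u) = mor_Lb [c] @ mor_Lb u"
  "NO_MATCH [] u \<Longrightarrow> mor_Ra (c # u) = mor_Ra [c] @ mor_Ra u"
  "NO_MATCH [] u \<Longrightarrow> mor_Rb (c # u) = mor_Rb [c] @ mor_Rb u"
  by (rule morphism_Cons, simp)+

lemma E_E: "mor_E \<circ> mor_E = id"
  by (rule morphism_eqI) (simp_all add: nonerasing_morphism nonerasing_comp)

lemma E_E_apply [simp]: "mor_E (mor_E u) = u"
  by (metis E_E comp_apply id_apply)

lemma E_conj:
  "mor_E \<circ> mor_La = mor_Lb \<circ> mor_E" "mor_E \<circ> mor_Lb = mor_La \<circ> mor_E"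
  "mor_E \<circ> mor_Ra = mor_Rb \<circ> mor_E" "mor_E \<circ> mor_Rb = mor_Ra \<circ> mor_E"
  by (rule morphism_eqI, simp_all add: nonerasing_morphism nonerasing_comp generator_Cons)+

lemma La_Ra_commute: "mor_La \<circ> mor_Ra = mor_Ra \<circ> mor_La"
  by (rule morphism_eqI) (simp_all add: nonerasing_morphism nonerasing_comp generator_Cons)

lemma Lb_Rb_commute: "mor_Lb \<circ> mor_Rb = mor_Rb \<circ> mor_Lb"
  by (rule morphism_eqI) (simp_all add: nonerasing_morphism nonerasing_comp generator_Cons)

lemma ext_E_E [simp]: "ext mor_E (ext mor_E w) = w"
  by (metis E_E ext_comp ext_id nonerasing_generator(1))

lemma ext_E_conj:
  "ext mor_E (ext mor_La w) = ext mor_Lb (ext mor_E w)"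
  "ext mor_E (ext mor_Lb w) = ext mor_La (ext mor_E w)"
  "ext mor_E (ext mor_Ra w) = ext mor_Rb (ext mor_E w)"
  "ext mor_E (ext mor_Rb w) = ext mor_Ra (ext mor_E w)"
  by (metis E_conj ext_comp nonerasing_generator)+

lemma ext_E_SCons [simp]:
  "ext mor_E (ltr_a ## w) = ltr_b ## ext mor_E w"
  "ext mor_E (ltr_b ## w) = ltr_a ## ext mor_E w"
  by (simp_all add: ext_SCons)

lemma a_Ra_eq_La_a: "ltr_a # mor_Ra u = mor_La u @ [ltr_a]"
proof (induction u)
  case (Cons c u)
  then show ?case by (cases c) (simp_all add: generator_Cons)
qed simp

text \<open>The finite identity \<open>a_Ra_eq_La_a\<close> applies to every prefix; its trailing a
  moves off to infinity.\<close>

lemma ext_Ra_conj: "ltr_a ## ext mor_Ra w = ext mor_La w"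
proof -
  have "inf_image mor_La w (ltr_a ## ext mor_Ra w)"
    unfolding inf_image_def prefix_of_inf_iff
  proof (intro conjI allI)
    fix n
    have "ltr_a ## ext mor_Ra w = (ltr_a # mor_Ra (stake n w)) @- ext mor_Ra (sdrop n w)"
      using ext_split[of mor_Ra w n] by simp
    then show "\<exists>v. ltr_a ## ext mor_Ra w = mor_La (stake n w) @- v"
      unfolding a_Ra_eq_La_a by auto
    show "\<exists>k. n \<le> length (mor_La (stake k w))"
      by (metis length_stake nonerasing_length nonerasing_generator(2))
  qed
  then show ?thesis by (simp add: inf_image_ext)
qed

lemma ext_Rb_conj: "ltr_b ## ext mor_Rb w = ext mor_Lb w"
proof -
  have "ext mor_E (ltr_a ## ext mor_Ra (ext mor_E w)) = ltr_b ## ext mor_Rb w"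
    by (simp add: ext_E_conj)
  moreover have "ext mor_E (ext mor_La (ext mor_E w)) = ext mor_Lb w"
    by (simp add: ext_E_conj)
  ultimately show ?thesis by (simp add: ext_Ra_conj)
qed

section \<open>Quasiperiodicity\<close>

text \<open>Each \<open>p n\<close> is a prefix of \<open>w\<close>, hence determined by its length;
  the covering becomes a sequence \<open>q\<close> of positions of \<open>u\<close>.\<close>

lemma quasiperiodic_iff_positions:
  "quasiperiodic w \<longleftrightarrow> (\<exists>u q. q 0 = 0 \<and>
     (\<forall>n. q n < q (Suc n) \<and> q (Suc n) \<le> q n + length u \<and> prefix_of_inf u (sdrop (q n) w)))"
proof
  assume "quasiperiodic w"
  then obtain u p where p: "p 0 = []" "\<And>n. length (p n) < length (p (Suc n))"
    "\<And>n. length (p (Suc n)) \<le> length (p n) + length u" "\<And>n. prefix_of_inf (p n @ u) w"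
    unfolding quasiperiodic_def by blast
  have "prefix_of_inf u (sdrop (length (p n)) w)" for n
    using p(4)[of n] by (auto simp: prefix_of_inf_iff sdrop_shift)
  with p show "\<exists>u q. q 0 = 0 \<and>
     (\<forall>n. q n < q (Suc n) \<and> q (Suc n) \<le> q n + length u \<and> prefix_of_inf u (sdrop (q n) w))"
    by (intro exI[of _ u] exI[of _ "\<lambda>n. length (p n)"]) simp
next
  assume "\<exists>u q. q 0 = 0 \<and>
     (\<forall>n. q n < q (Suc n) \<and> q (Suc n) \<le> q n + length u \<and> prefix_of_inf u (sdrop (q n) w))"
  then obtain u and q :: "nat \<Rightarrow> nat" where q: "q 0 = 0" "\<And>n. q n < q (Suc n)" "\<And>n. q (Suc n) \<le> q n + length u"
    "\<And>n. prefix_of_inf u (sdrop (q n) w)"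
    by blast
  have "prefix_of_inf (stake (q n) w @ u) w" for n
    using q(4)[of n] by (metis prefix_of_inf_iff shift_append stake_sdrop)
  with q show "quasiperiodic w"
    unfolding quasiperiodic_def
    by (intro exI[of _ u] exI[of _ "\<lambda>n. stake (q n) w"]) simp
qed

lemma quasiperiodicI:
  fixes q :: "nat \<Rightarrow> nat"
  assumes "q 0 = 0" "\<And>n. q n < q (Suc n)" "\<And>n. q (Suc n) \<le> q n + length u"
    "\<And>n. prefix_of_inf u (sdrop (q n) w)"
  shows "quasiperiodic w"
  using assms unfolding quasiperiodic_iff_positions by blast

lemma sdrop_ext: "nonerasing f \<Longrightarrow> sdrop (length (f (stake n w))) (ext f w) = ext f (sdrop n w)"
  by (subst ext_split[of f w n]) (simp_all add: sdrop_shift)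

text \<open>The new quasiperiod is \<open>f u\<close>. As \<open>q\<close> advances by at most
  \<open>length u\<close>, the stretch of \<open>w\<close> from one occurrence of \<open>u\<close>
  to the start of the next is a prefix of \<open>u\<close>, so the image positions are at most
  \<open>length (f u)\<close> apart.\<close>

lemma quasiperiodic_ext:
  assumes f: "nonerasing f" and "quasiperiodic w"
  shows "quasiperiodic (ext f w)"
proof -
  obtain u and q :: "nat \<Rightarrow> nat" where q: "q 0 = 0" "\<And>n. q n < q (Suc n)" "\<And>n. q (Suc n) \<le> q n + length u"
    "\<And>n. prefix_of_inf u (sdrop (q n) w)"
    using assms(2) unfolding quasiperiodic_iff_positions by blast
  have m: "morphism f" using f by (simp add: nonerasing_def)
  have step: "f (stake (q (Suc n)) w) = f (stake (q n) w) @ f (take (q (Suc n) - q n) u)" for n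
  proof -
    have "stake (q (Suc n) - q n) (sdrop (q n) w) = take (q (Suc n) - q n) u"
      using q(3)[of n] q(4)[of n] by (auto simp: prefix_of_inf_iff stake_shift)
    moreover have "stake (q (Suc n)) w = stake (q n) w @ stake (q (Suc n) - q n) (sdrop (q n) w)"
      using q(2)[of n] by simp
    ultimately show ?thesis using m by (simp add: morphism_append)
  qed
  show ?thesis
  proof (rule quasiperiodicI[where q = "\<lambda>n. length (f (stake (q n) w))" and u = "f u"])
    show "length (f (stake (q 0) w)) = 0" using q m by (simp add: morphism_Nil)
    fix n
    let ?d = "q (Suc n) - q n"
    have "length (f (take ?d u)) \<ge> 1"
      using nonerasing_length[OF f, of "take ?d u"] q(2)[of n] q(3)[of n] by auto
    then show "length (f (stake (q n) w)) < length (f (stake (q (Suc n)) w))"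
      unfolding step by (cases "f (take ?d u)") simp_all
    have "f u = f (take ?d u) @ f (drop ?d u)"
      using morphism_append[OF m, of "take ?d u" "drop ?d u"] by simp
    then show "length (f (stake (q (Suc n)) w)) \<le> length (f (stake (q n) w)) + length (f u)"
      by (simp add: step)
    obtain t where "sdrop (q n) w = u @- t" using q(4)[of n] by (auto simp: prefix_of_inf_iff)
    then show "prefix_of_inf (f u) (sdrop (length (f (stake (q n) w))) (ext f w))"
      using f by (auto simp: prefix_of_inf_iff sdrop_ext ext_shift)
  qed
qed

lemma quasiperiodic_ext_E [simp]: "quasiperiodic (ext mor_E w) \<longleftrightarrow> quasiperiodic w"
  by (metis ext_E_E nonerasing_generator(1) quasiperiodic_ext)

text \<open>The blocks are aba and ab, and every block begins with a. Hence aba occurs at the start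
  of each block, and block lengths 2 and 3 leave no gap.\<close>

lemma quasiperiodic_La_Lb: "quasiperiodic (ext mor_La (ext mor_Lb w))"
proof -
  let ?f = "mor_La \<circ> mor_Lb"
  have f: "nonerasing ?f" by (simp add: nonerasing_comp)
  have l: "?f [ltr_a] = [ltr_a, ltr_b, ltr_a]" "?f [ltr_b] = [ltr_a, ltr_b]"
    by (simp_all add: generator_Cons)
  have step: "?f (stake (Suc n) w) = ?f (stake n w) @ ?f [w !! n]" for n
  proof -
    have "stake (Suc n) w = stake n w @ [w !! n]"
      by (metis One_nat_def Suc_eq_plus1 sdrop_simps(1) stake.simps stake_add)
    then show ?thesis using f by (simp add: nonerasing_def morphism_append del: stake.simps comp_apply)
  qed
  have pre: "prefix_of_inf [ltr_a, ltr_b, ltr_a] (ext ?f v)" for v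
  proof -
    \<comment> \<open>Two letters are inspected because the block ab borrows the last a of aba from
      the next block.\<close>
    obtain c d t where v: "v = c ## d ## t" by (metis stream.exhaust)
    show ?thesis unfolding v prefix_of_inf_def
      by (cases c; cases d) (simp_all add: ext_SCons f l del: comp_apply)
  qed
  have "quasiperiodic (ext ?f w)"
  proof (rule quasiperiodicI[where q = "\<lambda>n. length (?f (stake n w))" and u = "[ltr_a, ltr_b, ltr_a]"])
    show "length (?f (stake 0 w)) = 0" by simp
    fix n
    have 1: "length (?f [w !! n]) \<in> {2, 3}" by (cases "w !! n") (simp_all only: l, simp_all)
    show "length (?f (stake n w)) < length (?f (stake (Suc n) w))"
      unfolding step using 1 by auto
    show "length (?f (stake (Suc n) w)) \<le> length (?f (stake n w)) + length [ltr_a, ltr_b, ltr_a]"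
      unfolding step using 1 by auto
    show "prefix_of_inf [ltr_a, ltr_b, ltr_a] (sdrop (length (?f (stake n w))) (ext ?f w))"
      unfolding sdrop_ext[OF f] by (rule pre)
  qed
  then show ?thesis by (simp add: ext_comp)
qed

text \<open>The identities \<open>R_a (a x) = L_a x\<close> and \<open>R_b (b x) = L_b x\<close> reduce both of the following cases to
  the morphism \<open>L_a L_b\<close>.\<close>

lemma quasiperiodic_Ra_Rb:
  assumes "shd w = ltr_a"
  shows "quasiperiodic (ext mor_Ra (ext mor_Rb w))"
proof -
  obtain x where w: "w = ltr_a ## x" using assms by (metis stream.collapse)
  have "ext mor_Rb w = ltr_a ## ext mor_Lb x"
    by (simp add: w ext_SCons ext_Rb_conj)
  then have "ext mor_Ra (ext mor_Rb w) = ext mor_La (ext mor_Lb x)"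
    by (simp add: ext_SCons ext_Ra_conj)
  then show ?thesis by (simp add: quasiperiodic_La_Lb)
qed

lemma quasiperiodic_La_Rb:
  assumes "shd w = ltr_b"
  shows "quasiperiodic (ext mor_La (ext mor_Rb w))"
proof -
  obtain x where w: "w = ltr_b ## x" using assms by (metis stream.collapse)
  have "ext mor_Rb w = ext mor_Lb x"
    by (simp add: w ext_SCons ext_Rb_conj)
  then show ?thesis by (simp add: quasiperiodic_La_Lb)
qed

lemma quasiperiodic_Lb_La: "quasiperiodic (ext mor_Lb (ext mor_La w))"
  using quasiperiodic_La_Lb[of "ext mor_E w"]
  by (metis ext_E_conj(1,2) quasiperiodic_ext_E)

lemma shd_ext_E: "shd (ext mor_E w) = ltr_a \<longleftrightarrow> shd w = ltr_b"
  by (cases "shd w") (simp_all add: shd_ext)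

lemma quasiperiodic_Rb_Ra: "shd w = ltr_b \<Longrightarrow> quasiperiodic (ext mor_Rb (ext mor_Ra w))"
  using quasiperiodic_Ra_Rb[of "ext mor_E w"]
  by (metis ext_E_conj(3,4) quasiperiodic_ext_E shd_ext_E)

section \<open>Products of generators\<close>

lemma comp_star_induct [consumes 1, case_names id step]:
  assumes "f \<in> comp_star X" "P id"
    "\<And>s g. s \<in> X \<Longrightarrow> g \<in> comp_star X \<Longrightarrow> P g \<Longrightarrow> P (s \<circ> g)"
  shows "P f"
  using assms(1)
proof (induction f rule: comp_star.induct)
  case comp_star_id
  show ?case using assms(2) by (simp add: id_def)
next
  case (comp_star_step s g)
  then show ?case using assms(3)[of s g] by (simp add: comp_def)
qed

lemma comp_star_cases [consumes 1, case_names id step]: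
  assumes "f \<in> comp_star X"
  obtains "f = id" | s g where "f = s \<circ> g" "s \<in> X" "g \<in> comp_star X"
  using assms by (induction f rule: comp_star_induct) blast+

lemma comp_star_single: "f \<in> X \<Longrightarrow> f \<in> comp_star X"
  using comp_star_step[OF _ comp_star_id] by fastforce

lemma comp_star_mono: "f \<in> comp_star X \<Longrightarrow> X \<subseteq> Y \<Longrightarrow> f \<in> comp_star Y"
  by (induction f rule: comp_star_induct) (auto intro: comp_star_id comp_star_step)

text \<open>The inductive definition peels factors off on the left; the rightmost factor is the one
  that meets a word first, and so the one that can turn it into a quasiperiodic word.\<close>

lemma comp_star_snoc_cases:
  "f \<in> comp_star X \<Longrightarrow> f = id \<or> (\<exists>g\<in>comp_star X. \<exists>s\<in>X. f = g \<circ> s)"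
proof (induction f rule: comp_star_induct)
  case (step s f)
  then show ?case
    by (metis comp_assoc comp_id comp_star_step comp_star_id id_comp)
qed simp

lemma nonerasing_comp_star: "f \<in> comp_star X \<Longrightarrow> \<forall>s\<in>X. nonerasing s \<Longrightarrow> nonerasing f"
  by (induction f rule: comp_star_induct) (auto intro: nonerasing_comp)

section \<open>Exchange of the two letters, and the two kinds of products\<close>

definition conj_E :: "(word \<Rightarrow> word) \<Rightarrow> word \<Rightarrow> word" where
  "conj_E f = mor_E \<circ> f \<circ> mor_E"

lemma conj_E_conj_E [simp]: "conj_E (conj_E f) = f"
  by (simp add: conj_E_def fun_eq_iff)

lemma conj_E_id [simp]: "conj_E id = id"
  by (simp add: conj_E_def E_E)

lemma conj_E_comp: "conj_E (f \<circ> g) = conj_E f \<circ> conj_E g"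
  by (simp add: conj_E_def fun_eq_iff)

lemma conj_E_generator [simp]:
  "conj_E mor_La = mor_Lb" "conj_E mor_Lb = mor_La" "conj_E mor_Ra = mor_Rb" "conj_E mor_Rb = mor_Ra"
  by (simp_all add: conj_E_def E_conj comp_assoc E_E)

lemma E_comp: "mor_E \<circ> f = conj_E f \<circ> mor_E"
  by (simp add: conj_E_def fun_eq_iff)

text \<open>Keeps the simplifier from turning \<open>f \<circ> g\<close> and \<open>id\<close> into abstractions.\<close>

declare id_apply [simp del] comp_apply [simp del]

lemma comp_star_conj_E: "f \<in> comp_star X \<Longrightarrow> conj_E f \<in> comp_star (conj_E ` X)"
proof (induction f rule: comp_star_induct)
  case id then show ?case by (simp add: comp_star_id)
next
  case (step f g)
  then show ?case by (simp add: conj_E_comp comp_star_step)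
qed

abbreviation a_type :: "(word \<Rightarrow> word) set" where
  "a_type \<equiv> comp_star {mor_La, mor_Rb} \<odot> comp_star {mor_La, mor_Ra}"

abbreviation b_type :: "(word \<Rightarrow> word) set" where
  "b_type \<equiv> comp_star {mor_Lb, mor_Ra} \<odot> comp_star {mor_Lb, mor_Rb}"

lemma comp_set_iff: "f \<in> X \<odot> Y \<longleftrightarrow> (\<exists>g\<in>X. \<exists>h\<in>Y. f = g \<circ> h)"
  by (auto simp: comp_set_def)

text \<open>The theorem brackets its products to the left, whereas \<open>a_type\<close> and
  \<open>b_type\<close> group the two starred factors.\<close>

lemma comp_set_assoc: "X \<odot> Y \<odot> Z = X \<odot> (Y \<odot> Z)"
proof (rule set_eqI)
  fix f
  have "f \<in> X \<odot> Y \<odot> Z \<longleftrightarrow> (\<exists>g\<in>X. \<exists>h\<in>Y. \<exists>k\<in>Z. f = g \<circ> h \<circ> k)"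
    unfolding comp_set_iff Bex_def by blast
  also have "\<dots> \<longleftrightarrow> f \<in> X \<odot> (Y \<odot> Z)"
    unfolding comp_set_iff Bex_def comp_assoc by blast
  finally show "f \<in> X \<odot> Y \<odot> Z \<longleftrightarrow> f \<in> X \<odot> (Y \<odot> Z)" .
qed

lemma comp_setI: "f \<in> X \<Longrightarrow> g \<in> Y \<Longrightarrow> f \<circ> g \<in> X \<odot> Y"
  by (auto simp: comp_set_def)

lemma conj_E_a_type: "f \<in> a_type \<Longrightarrow> conj_E f \<in> b_type"
  using comp_star_conj_E[of _ "{mor_La, mor_Rb}"] comp_star_conj_E[of _ "{mor_La, mor_Ra}"]
  by (fastforce simp: comp_set_def conj_E_comp)

lemma conj_E_b_type: "f \<in> b_type \<Longrightarrow> conj_E f \<in> a_type"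
  using comp_star_conj_E[of _ "{mor_Lb, mor_Ra}"] comp_star_conj_E[of _ "{mor_Lb, mor_Rb}"]
  by (fastforce simp: comp_set_def conj_E_comp)

lemma nonerasing_a_type: "f \<in> a_type \<Longrightarrow> nonerasing f"
  by (auto simp: comp_set_def intro!: nonerasing_comp elim!: nonerasing_comp_star)

lemma nonerasing_b_type: "f \<in> b_type \<Longrightarrow> nonerasing f"
  by (auto simp: comp_set_def intro!: nonerasing_comp elim!: nonerasing_comp_star)

lemma id_a_type: "id \<in> a_type"
  using comp_setI[OF comp_star_id comp_star_id] by simp

section \<open>Strongly quasiperiodic products\<close>

definition strongly_quasiperiodic :: "(word \<Rightarrow> word) \<Rightarrow> bool" where
  "strongly_quasiperiodic f \<longleftrightarrow> nonerasing f \<and> (\<forall>w. quasiperiodic (ext f w))"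

lemma strongly_quasiperiodic_comp_left:
  "nonerasing g \<Longrightarrow> strongly_quasiperiodic f \<Longrightarrow> strongly_quasiperiodic (g \<circ> f)"
  by (simp add: strongly_quasiperiodic_def nonerasing_comp ext_comp quasiperiodic_ext)

lemma strongly_quasiperiodic_comp_right:
  "strongly_quasiperiodic f \<Longrightarrow> nonerasing g \<Longrightarrow> strongly_quasiperiodic (f \<circ> g)"
  by (simp add: strongly_quasiperiodic_def nonerasing_comp ext_comp)

lemma strongly_quasiperiodic_conj_E: "strongly_quasiperiodic f \<Longrightarrow> strongly_quasiperiodic (conj_E f)"
  by (simp add: conj_E_def strongly_quasiperiodic_comp_left strongly_quasiperiodic_comp_right)

lemma strongly_quasiperiodic_Lb_La: "strongly_quasiperiodic (mor_Lb \<circ> mor_La)"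
  by (simp add: strongly_quasiperiodic_def nonerasing_comp ext_comp quasiperiodic_Lb_La)

text \<open>The first letter of \<open>w\<close> decides: on a, R_a R_b already gives a
  quasiperiodic word; on b, L_a and R_a are interchanged and L_a R_b does. The generator left over
  preserves quasiperiodicity.\<close>

lemma strongly_quasiperiodic_La_Ra_Rb: "strongly_quasiperiodic (mor_La \<circ> mor_Ra \<circ> mor_Rb)"
  unfolding strongly_quasiperiodic_def
proof (intro conjI allI)
  show "nonerasing (mor_La \<circ> mor_Ra \<circ> mor_Rb)" by (simp add: nonerasing_comp)
  fix w
  show "quasiperiodic (ext (mor_La \<circ> mor_Ra \<circ> mor_Rb) w)"
  proof (cases "shd w")
    case ltr_a
    then have "quasiperiodic (ext mor_La (ext mor_Ra (ext mor_Rb w)))"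
      by (simp add: quasiperiodic_ext quasiperiodic_Ra_Rb)
    then show ?thesis by (simp add: nonerasing_comp ext_comp)
  next
    case ltr_b
    then have "quasiperiodic (ext mor_Ra (ext mor_La (ext mor_Rb w)))"
      by (simp add: quasiperiodic_ext quasiperiodic_La_Rb)
    then show ?thesis unfolding La_Ra_commute by (simp add: nonerasing_comp ext_comp)
  qed
qed

lemma strongly_quasiperiodic_Lb_Rb_Ra: "strongly_quasiperiodic (mor_Lb \<circ> mor_Rb \<circ> mor_Ra)"
  using strongly_quasiperiodic_conj_E[OF strongly_quasiperiodic_La_Ra_Rb] by (simp add: conj_E_comp)

text \<open>With \<open>keeps_first\<close>, one of the two effects on first letters that decide
  whether R_a R_b, applied afterwards, falls under \<open>quasiperiodic_Ra_Rb\<close>.\<close>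

definition starts_with_a :: "(word \<Rightarrow> word) \<Rightarrow> bool" where
  "starts_with_a f \<longleftrightarrow> (\<forall>w. shd (ext f w) = ltr_a)"

definition keeps_first :: "(word \<Rightarrow> word) \<Rightarrow> bool" where
  "keeps_first f \<longleftrightarrow> (\<forall>w. shd (ext f w) = shd w)"

lemma keeps_first_R: "keeps_first mor_Ra" "keeps_first mor_Rb"
proof -
  show "keeps_first mor_Ra" unfolding keeps_first_def
    by (intro allI, case_tac "shd w") (simp_all add: shd_ext)
  show "keeps_first mor_Rb" unfolding keeps_first_def
    by (intro allI, case_tac "shd w") (simp_all add: shd_ext)
qed

lemma starts_with_a_La: "starts_with_a mor_La"
  unfolding starts_with_a_def by (metis ext_Ra_conj stream.sel(1))

text \<open>A factor L_a anywhere forces a, which the R_a factors applied later keep; a power of R_a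
  changes no first letter.\<close>

lemma La_Ra_cases:
  assumes "h \<in> comp_star {mor_La, mor_Ra}"
  shows "starts_with_a h \<or> keeps_first h"
  using assms
proof (induction h rule: comp_star_induct)
  case id then show ?case by (simp add: keeps_first_def)
next
  case (step s h)
  have h: "nonerasing h" using step(2) by (auto elim!: nonerasing_comp_star)
  show ?case
  proof (cases "s = mor_La")
    case True
    then show ?thesis using starts_with_a_La h by (simp add: starts_with_a_def ext_comp)
  next
    case False
    then have "s = mor_Ra" using step(1) by simp
    then show ?thesis using step.IH keeps_first_R h
      by (simp add: starts_with_a_def keeps_first_def ext_comp)
  qed
qed

text \<open>This is what has to be known of a product standing to the right of R_a R_b. The third
  case comes from a power of R_b followed by a nontrivial power of R_a: a first letter a is served
  by R_a R_b, a first letter b by the pair R_b R_a further inside.\<close>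

lemma a_type_cases:
  assumes g: "g \<in> comp_star {mor_La, mor_Rb}" and h: "h \<in> comp_star {mor_La, mor_Ra}"
  shows "g \<circ> h \<in> comp_star {mor_Rb} \<or> starts_with_a (g \<circ> h) \<or>
    (keeps_first (g \<circ> h) \<and> (\<forall>w. shd w = ltr_b \<longrightarrow> quasiperiodic (ext (mor_Rb \<circ> (g \<circ> h)) w)))"
  using g
proof (induction g rule: comp_star_induct)
  case id
  from h show ?case
  proof (cases rule: comp_star_cases)
    case id
    then show ?thesis by (simp add: comp_star_id)
  next
    case (step s h1)
    have h1: "nonerasing h1" using step(3) by (auto elim!: nonerasing_comp_star)
    show ?thesis
    proof (cases "s = mor_Ra \<and> keeps_first h1")
      case True
      then show ?thesis using h1 keeps_first_R quasiperiodic_Rb_Ra step(1)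
        by (simp add: keeps_first_def ext_comp nonerasing_comp)
    next
      case False
      then have "s = mor_La \<or> starts_with_a h1"
        using step La_Ra_cases by blast
      then have "starts_with_a h"
        using h1 starts_with_a_La keeps_first_R step(1,2)
        by (auto simp: starts_with_a_def keeps_first_def ext_comp)
      then show ?thesis by simp
    qed
  qed
next
  case (step s g)
  have gh: "nonerasing (g \<circ> h)"
    using step(2) h by (auto intro!: nonerasing_comp elim!: nonerasing_comp_star)
  show ?case
  proof (cases "s = mor_La")
    case True
    then show ?thesis using starts_with_a_La gh by (simp add: starts_with_a_def ext_comp comp_assoc)
  next
    case False
    then have s: "s = mor_Rb" using step(1) by simp
    from step.IH show ?thesis
    proof (elim disjE conjE)
      assume "g \<circ> h \<in> comp_star {mor_Rb}"
      then show ?thesis by (simp add: s comp_assoc comp_star_step)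
    next
      assume "starts_with_a (g \<circ> h)"
      then show ?thesis using keeps_first_R gh
        by (simp add: s starts_with_a_def keeps_first_def ext_comp comp_assoc)
    next
      assume "keeps_first (g \<circ> h)" "\<forall>w. shd w = ltr_b \<longrightarrow> quasiperiodic (ext (mor_Rb \<circ> (g \<circ> h)) w)"
      then show ?thesis using keeps_first_R gh
        by (simp add: s keeps_first_def ext_comp comp_assoc nonerasing_comp quasiperiodic_ext)
    qed
  qed
qed

text \<open>R_a passes the leading L_a factors of \<open>g\<close>. If \<open>g\<close> is used up,
  \<open>h\<close> absorbs it; otherwise it meets an R_b, and the result is strongly quasiperiodic
  unless only R_b factors follow. That exception is the third alternative, a product of the second
  kind.\<close>

lemma Ra_comp_a_type:
  assumes g: "g \<in> comp_star {mor_La, mor_Rb}" and h: "h \<in> comp_star {mor_La, mor_Ra}"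
  shows "mor_Ra \<circ> (g \<circ> h) \<in> a_type \<or> strongly_quasiperiodic (mor_Ra \<circ> (g \<circ> h)) \<or>
    (\<exists>r\<in>comp_star {mor_Rb}. mor_Ra \<circ> (g \<circ> h) = mor_Ra \<circ> mor_Rb \<circ> r)"
  using g
proof (induction g rule: comp_star_induct)
  case id
  have "mor_Ra \<circ> h \<in> comp_star {mor_La, mor_Ra}" using h by (simp add: comp_star_step)
  then have "id \<circ> (mor_Ra \<circ> h) \<in> a_type" by (intro comp_setI comp_star_id)
  then show ?case by simp
next
  case (step s g)
  have gh: "nonerasing (g \<circ> h)"
    using step(2) h by (auto intro!: nonerasing_comp elim!: nonerasing_comp_star)
  show ?case
  proof (cases "s = mor_La")
    case True
    have eq: "mor_Ra \<circ> (mor_La \<circ> g \<circ> h) = mor_La \<circ> (mor_Ra \<circ> (g \<circ> h))"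
      by (metis La_Ra_commute comp_assoc)
    from step.IH show ?thesis unfolding True eq
    proof (elim disjE bexE)
      assume "mor_Ra \<circ> (g \<circ> h) \<in> a_type"
      then obtain g1 h1 where *: "mor_Ra \<circ> (g \<circ> h) = g1 \<circ> h1" "g1 \<in> comp_star {mor_La, mor_Rb}"
        "h1 \<in> comp_star {mor_La, mor_Ra}" by (auto simp: comp_set_def)
      have "(mor_La \<circ> g1) \<circ> h1 \<in> a_type" using * by (intro comp_setI comp_star_step) auto
      then show "mor_La \<circ> (mor_Ra \<circ> (g \<circ> h)) \<in> a_type \<or> strongly_quasiperiodic (mor_La \<circ> (mor_Ra \<circ> (g \<circ> h))) \<or>
        (\<exists>r\<in>comp_star {mor_Rb}. mor_La \<circ> (mor_Ra \<circ> (g \<circ> h)) = mor_Ra \<circ> mor_Rb \<circ> r)"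
        by (simp add: * comp_assoc)
    next
      assume "strongly_quasiperiodic (mor_Ra \<circ> (g \<circ> h))"
      then show "mor_La \<circ> (mor_Ra \<circ> (g \<circ> h)) \<in> a_type \<or> strongly_quasiperiodic (mor_La \<circ> (mor_Ra \<circ> (g \<circ> h))) \<or>
        (\<exists>r\<in>comp_star {mor_Rb}. mor_La \<circ> (mor_Ra \<circ> (g \<circ> h)) = mor_Ra \<circ> mor_Rb \<circ> r)"
        by (simp add: strongly_quasiperiodic_comp_left)
    next
      \<comment> \<open>An L_a in front of R_a R_b completes the pattern L_a R_a R_b.\<close>
      fix r assume r: "r \<in> comp_star {mor_Rb}" "mor_Ra \<circ> (g \<circ> h) = mor_Ra \<circ> mor_Rb \<circ> r"
      then have "nonerasing r" by (auto elim!: nonerasing_comp_star)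
      then show "mor_La \<circ> (mor_Ra \<circ> (g \<circ> h)) \<in> a_type \<or> strongly_quasiperiodic (mor_La \<circ> (mor_Ra \<circ> (g \<circ> h))) \<or>
        (\<exists>r\<in>comp_star {mor_Rb}. mor_La \<circ> (mor_Ra \<circ> (g \<circ> h)) = mor_Ra \<circ> mor_Rb \<circ> r)"
        using strongly_quasiperiodic_comp_right[OF strongly_quasiperiodic_La_Ra_Rb]
        unfolding r(2) by (simp add: comp_assoc)
    qed
  next
    case False
    then have s: "s = mor_Rb" using step(1) by simp
    let ?f = "mor_Ra \<circ> (s \<circ> g \<circ> h)"
    have f: "nonerasing ?f" "ext ?f w = ext mor_Ra (ext mor_Rb (ext (g \<circ> h) w))" for w
      using gh by (simp_all add: s comp_assoc nonerasing_comp ext_comp)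
    from a_type_cases[OF step(2) h] show ?thesis
    proof (elim disjE conjE)
      assume "g \<circ> h \<in> comp_star {mor_Rb}"
      then show ?thesis by (auto simp: s comp_assoc)
    next
      assume "starts_with_a (g \<circ> h)"
      then have "strongly_quasiperiodic ?f"
        using f by (simp add: strongly_quasiperiodic_def starts_with_a_def quasiperiodic_Ra_Rb)
      then show ?thesis by simp
    next
      assume *: "keeps_first (g \<circ> h)"
        "\<forall>w. shd w = ltr_b \<longrightarrow> quasiperiodic (ext (mor_Rb \<circ> (g \<circ> h)) w)"
      have "quasiperiodic (ext ?f w)" for w
      proof (cases "shd w")
        case ltr_a
        then show ?thesis using *(1) by (simp add: f keeps_first_def quasiperiodic_Ra_Rb)
      next
        case ltr_b
        then show ?thesis using *(2) gh by (simp add: f ext_comp quasiperiodic_ext)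
      qed
      then show ?thesis using f by (simp add: strongly_quasiperiodic_def)
    qed
  qed
qed

text \<open>As L_a and R_a commute, any L_a can be brought to the front, where it can meet a
  preceding L_b.\<close>

lemma La_Ra_contains_La:
  assumes "h \<in> comp_star {mor_La, mor_Ra}"
  shows "h \<in> comp_star {mor_Ra} \<or> (\<exists>h'\<in>comp_star {mor_La, mor_Ra}. h = mor_La \<circ> h')"
  using assms
proof (induction h rule: comp_star_induct)
  case id then show ?case by (simp add: comp_star_id)
next
  case (step s h)
  show ?case
  proof (cases "s = mor_La")
    case False
    then have s: "s = mor_Ra" using step(1) by simp
    from step.IH show ?thesis
    proof (elim disjE bexE)
      assume "h \<in> comp_star {mor_Ra}"
      then show ?thesis by (simp add: s comp_star_step)
    next
      fix h' assume h': "h' \<in> comp_star {mor_La, mor_Ra}" "h = mor_La \<circ> h'"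
      then have "s \<circ> h = mor_La \<circ> (mor_Ra \<circ> h')" by (metis s La_Ra_commute comp_assoc)
      then show ?thesis using h' by (meson comp_star_step insertCI)
    qed
  qed (use step in auto)
qed

text \<open>L_b passes R_b and is strongly quasiperiodic together with an L_a. If no L_a occurs, the
  product is L_b R_b^i R_a^j; for i and j both positive it contains L_b R_b R_a, so only pure powers
  of R_b or of R_a remain.\<close>

lemma Lb_comp_a_type:
  assumes g: "g \<in> comp_star {mor_La, mor_Rb}" and h: "h \<in> comp_star {mor_La, mor_Ra}"
  shows "strongly_quasiperiodic (mor_Lb \<circ> (g \<circ> h)) \<or>
    (\<exists>r\<in>comp_star {mor_Rb} \<union> comp_star {mor_Ra}. mor_Lb \<circ> (g \<circ> h) = mor_Lb \<circ> r)"
  using g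
proof (induction g rule: comp_star_induct)
  case id
  from La_Ra_contains_La[OF h] show ?case
  proof (elim disjE bexE)
    fix h' assume h': "h' \<in> comp_star {mor_La, mor_Ra}" "h = mor_La \<circ> h'"
    then have "nonerasing h'" by (auto elim!: nonerasing_comp_star)
    then have "strongly_quasiperiodic (mor_Lb \<circ> h)"
      using strongly_quasiperiodic_comp_right[OF strongly_quasiperiodic_Lb_La]
      by (simp add: h'(2) comp_assoc)
    then show ?thesis by simp
  qed auto
next
  case (step s g)
  have gh: "nonerasing (g \<circ> h)"
    using step(2) h by (auto intro!: nonerasing_comp elim!: nonerasing_comp_star)
  show ?case
  proof (cases "s = mor_La")
    case True
    have "strongly_quasiperiodic (mor_Lb \<circ> (s \<circ> g \<circ> h))"
      using strongly_quasiperiodic_comp_right[OF strongly_quasiperiodic_Lb_La gh]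
      by (simp add: True comp_assoc)
    then show ?thesis by simp
  next
    case False
    then have s: "s = mor_Rb" using step(1) by simp
    have eq: "mor_Lb \<circ> (s \<circ> g \<circ> h) = mor_Rb \<circ> (mor_Lb \<circ> (g \<circ> h))"
      by (metis s Lb_Rb_commute comp_assoc)
    from step.IH show ?thesis
    proof (elim disjE bexE UnE)
      assume "strongly_quasiperiodic (mor_Lb \<circ> (g \<circ> h))"
      then show ?thesis by (simp add: eq strongly_quasiperiodic_comp_left)
    next
      fix r assume r: "mor_Lb \<circ> (g \<circ> h) = mor_Lb \<circ> r" "r \<in> comp_star {mor_Rb}"
      then have "mor_Lb \<circ> (s \<circ> g \<circ> h) = mor_Lb \<circ> (mor_Rb \<circ> r)"
        by (metis eq Lb_Rb_commute comp_assoc)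
      moreover have "mor_Rb \<circ> r \<in> comp_star {mor_Rb}" using r by (simp add: comp_star_step)
      ultimately show ?thesis by blast
    next
      fix r assume r: "mor_Lb \<circ> (g \<circ> h) = mor_Lb \<circ> r" "r \<in> comp_star {mor_Ra}"
      then have eq': "mor_Lb \<circ> (s \<circ> g \<circ> h) = mor_Lb \<circ> mor_Rb \<circ> r"
        by (metis eq Lb_Rb_commute comp_assoc)
      from r(2) show ?thesis
      proof (cases rule: comp_star_cases)
        case id
        then have "mor_Lb \<circ> (s \<circ> g \<circ> h) = mor_Lb \<circ> mor_Rb" using eq' by simp
        then show ?thesis using comp_star_single[of mor_Rb "{mor_Rb}"] by blast
      next
        case (step t r')
        then have "nonerasing r'" by (auto elim!: nonerasing_comp_star)
        then have "strongly_quasiperiodic (mor_Lb \<circ> (s \<circ> g \<circ> h))"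
          using step strongly_quasiperiodic_comp_right[OF strongly_quasiperiodic_Lb_Rb_Ra]
          unfolding eq' by (simp add: comp_assoc)
        then show ?thesis by simp
      qed
    qed
  qed
qed

lemma generator_comp_a_type:
  assumes "f \<in> a_type" "s \<in> {mor_La, mor_Lb, mor_Ra, mor_Rb}"
  shows "s \<circ> f \<in> a_type \<union> b_type \<or> strongly_quasiperiodic (s \<circ> f)"
proof -
  obtain g h where f: "f = g \<circ> h" and g: "g \<in> comp_star {mor_La, mor_Rb}"
    and h: "h \<in> comp_star {mor_La, mor_Ra}"
    using assms(1) by (auto simp: comp_set_def)
  consider "s = mor_La \<or> s = mor_Rb" | "s = mor_Ra" | "s = mor_Lb" using assms(2) by blast
  then show ?thesis
  proof cases
    case 1
    then have "(s \<circ> g) \<circ> h \<in> a_type" using g h by (intro comp_setI comp_star_step) auto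
    then show ?thesis by (simp add: f comp_assoc)
  next
    case 2
    from Ra_comp_a_type[OF g h] show ?thesis unfolding 2 f
    proof (elim disjE bexE)
      fix r assume r: "r \<in> comp_star {mor_Rb}" "mor_Ra \<circ> (g \<circ> h) = mor_Ra \<circ> mor_Rb \<circ> r"
      have "mor_Ra \<circ> (mor_Rb \<circ> r) \<in> b_type"
        using r(1) comp_star_single[of mor_Ra] comp_star_mono[of r "{mor_Rb}"]
        by (intro comp_setI comp_star_step) auto
      then show "mor_Ra \<circ> (g \<circ> h) \<in> a_type \<union> b_type \<or> strongly_quasiperiodic (mor_Ra \<circ> (g \<circ> h))"
        by (simp add: r comp_assoc)
    qed auto
  next
    case 3
    from Lb_comp_a_type[OF g h] show ?thesis unfolding 3 f
    proof (elim disjE bexE UnE)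
      fix r assume r: "mor_Lb \<circ> (g \<circ> h) = mor_Lb \<circ> r" "r \<in> comp_star {mor_Rb}"
      have "id \<circ> (mor_Lb \<circ> r) \<in> b_type"
        using r(2) by (intro comp_setI comp_star_id comp_star_step) (auto intro: comp_star_mono)
      then show "mor_Lb \<circ> (g \<circ> h) \<in> a_type \<union> b_type \<or> strongly_quasiperiodic (mor_Lb \<circ> (g \<circ> h))"
        by (simp add: r)
    next
      fix r assume r: "mor_Lb \<circ> (g \<circ> h) = mor_Lb \<circ> r" "r \<in> comp_star {mor_Ra}"
      have "(mor_Lb \<circ> r) \<circ> id \<in> b_type"
        using r(2) by (intro comp_setI comp_star_id comp_star_step) (auto intro: comp_star_mono)
      then show "mor_Lb \<circ> (g \<circ> h) \<in> a_type \<union> b_type \<or> strongly_quasiperiodic (mor_Lb \<circ> (g \<circ> h))"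
        by (simp add: r)
    qed auto
  qed
qed

lemma generator_comp:
  assumes "f \<in> a_type \<union> b_type" "s \<in> {mor_La, mor_Lb, mor_Ra, mor_Rb}"
  shows "s \<circ> f \<in> a_type \<union> b_type \<or> strongly_quasiperiodic (s \<circ> f)"
proof (cases "f \<in> a_type")
  case True then show ?thesis using generator_comp_a_type assms(2) by blast
next
  case False
  then have "conj_E f \<in> a_type" using assms(1) conj_E_b_type by blast
  moreover have "conj_E s \<in> {mor_La, mor_Lb, mor_Ra, mor_Rb}" using assms(2) by auto
  ultimately have "conj_E (s \<circ> f) \<in> a_type \<union> b_type \<or> strongly_quasiperiodic (conj_E (s \<circ> f))"
    unfolding conj_E_comp by (rule generator_comp_a_type)
  then show ?thesis
    using conj_E_a_type[of "conj_E (s \<circ> f)"] conj_E_b_type[of "conj_E (s \<circ> f)"]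
      strongly_quasiperiodic_conj_E[of "conj_E (s \<circ> f)"] by auto
qed

section \<open>Infinite Lyndon words\<close>

definition lex_less :: "infword \<Rightarrow> infword \<Rightarrow> bool" where
  "lex_less v w \<longleftrightarrow> (\<exists>z x y. v = z @- ltr_a ## x \<and> w = z @- ltr_b ## y)"

definition lyndon :: "infword \<Rightarrow> bool" where
  "lyndon w \<longleftrightarrow> shd w = ltr_a \<and> (\<forall>k>0. lex_less w (sdrop k w))"

lemma lex_lessE:
  assumes "lex_less v w"
  obtains n where "\<And>i. i < n \<Longrightarrow> v !! i = w !! i" "v !! n = ltr_a" "w !! n = ltr_b"
proof -
  obtain z x y where "v = z @- ltr_a ## x" "w = z @- ltr_b ## y"
    using assms unfolding lex_less_def by blast
  then show thesis by (intro that[of "length z"]) simp_all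
qed

lemma covering_position:
  fixes q :: "nat \<Rightarrow> nat"
  assumes "q 0 = 0" "\<And>n. q n < q (Suc n)" "\<And>n. q (Suc n) \<le> q n + L"
  shows "\<exists>n. q n \<le> i \<and> i < q n + L"
proof (induction i)
  case 0
  have "L > 0" using assms(2,3)[of 0] by linarith
  then show ?case using assms(1) by (intro exI[of _ 0]) simp
next
  case (Suc i)
  then obtain n where n: "q n \<le> i" "i < q n + L" by blast
  show ?case
  proof (cases "Suc i < q n + L")
    case True then show ?thesis using n by (intro exI[of _ n]) simp
  next
    case False
    then show ?thesis using n assms(2,3)[of n] by (intro exI[of _ "Suc n"]) linarith
  qed
qed

text \<open>The letter \<open>b\<close> at which the suffix starting at the second occurrence of the quasiperiod exceeds
  the word is covered by a later occurrence, and the suffix starting there is too small.\<close>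

lemma lyndon_not_quasiperiodic:
  assumes "lyndon w"
  shows "\<not> quasiperiodic w"
proof
  assume "quasiperiodic w"
  then obtain u and q :: "nat \<Rightarrow> nat" where q: "q 0 = 0" "\<And>n. q n < q (Suc n)"
    "\<And>n. q (Suc n) \<le> q n + length u" "\<And>n. prefix_of_inf u (sdrop (q n) w)"
    unfolding quasiperiodic_iff_positions by blast
  have u: "w !! (q n + i) = u ! i" if "i < length u" for n i
  proof -
    obtain t where "sdrop (q n) w = u @- t" using q(4) prefix_of_inf_iff by blast
    then show ?thesis using that by (metis sdrop_snth shift_snth_less)
  qed
  define d where "d = q 1"
  have d: "d > 0" using q(1) q(2)[of 0] by (simp add: d_def)
  then have "lex_less w (sdrop d w)" using assms by (simp add: lyndon_def)
  then obtain l where l: "\<And>i. i < l \<Longrightarrow> w !! i = w !! (d + i)" "w !! l = ltr_a" "w !! (d + l) = ltr_b"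
    by (elim lex_lessE) (auto simp: sdrop_snth)
  \<comment> \<open>The occurrences of \<open>u\<close> at positions 0 and \<open>d\<close> agree,
    so the first difference lies beyond them.\<close>
  have lu: "length u \<le> l"
  proof (rule ccontr)
    assume "\<not> length u \<le> l"
    then have "w !! l = w !! (d + l)" using u[of l 0] u[of l 1] q(1) by (simp add: d_def)
    then show False using l(2,3) by simp
  qed
  obtain n where n: "q n \<le> d + l" "d + l < q n + length u"
    using covering_position[OF q(1-3)] by blast
  define k t where "k = q n - d" and "t = d + l - q n"
  have kt: "k > 0" "q n = d + k" "l = k + t" "t < length u" using n lu by (auto simp: k_def t_def)
  have eq: "w !! (k + i) = w !! i" if "i < t" for i
  proof -
    have "w !! (k + i) = w !! (d + (k + i))" using l(1)[of "k + i"] that kt(3) by simp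
    also have "\<dots> = u ! i" using u[of i n] that kt(2,4) by (simp add: add.assoc)
    also have "\<dots> = w !! i" using u[of i 0] that kt(4) q(1) by simp
    finally show ?thesis .
  qed
  have "w !! t = u ! t" using u[of t 0] kt(4) q(1) by simp
  also have "\<dots> = w !! (d + l)" using u[of t n] kt(2-4) by (simp add: add.assoc)
  finally have wt: "w !! t = ltr_b" using l(3) by simp
  have "lex_less w (sdrop k w)" using assms kt by (simp add: lyndon_def)
  then obtain m where m: "\<And>i. i < m \<Longrightarrow> w !! i = w !! (k + i)" "w !! m = ltr_a" "w !! (k + m) = ltr_b"
    by (elim lex_lessE) (auto simp: sdrop_snth)
  \<comment> \<open>The suffix at \<open>k\<close> agrees with \<open>w\<close> on \<open>t\<close>
    letters and then has a where \<open>w\<close> has b. It is smaller than \<open>w\<close>, so no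
    \<open>m\<close> can be the first difference claimed for it.\<close>
  consider "m < t" | "m = t" | "t < m" by linarith
  then show False
  proof cases
    case 1 then show False using m(2,3) eq[of m] by simp
  next
    case 2 then show False using m(2) wt by simp
  next
    case 3 then show False using m(1)[of t] wt l(2) kt(3) by simp
  qed
qed

text \<open>Under L_a the differing letters yield aa and ab, because every L_a-image starts with a;
  the difference moves one place to the right. Under R_b they yield ab and b, which differ at
  once.\<close>

lemma lex_less_ext:
  assumes "lex_less v w"
  shows "lex_less (ext mor_La v) (ext mor_La w)" "lex_less (ext mor_Rb v) (ext mor_Rb w)"
proof -
  obtain z x y where zxy: "v = z @- ltr_a ## x" "w = z @- ltr_b ## y"
    using assms unfolding lex_less_def by blast
  have "ext mor_La v = (mor_La z @ [ltr_a]) @- ltr_a ## ext mor_Ra x"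
    by (simp add: zxy ext_shift ext_SCons ext_Ra_conj)
  moreover have "ext mor_La w = (mor_La z @ [ltr_a]) @- ltr_b ## ext mor_La y"
    by (simp add: zxy ext_shift ext_SCons)
  ultimately show "lex_less (ext mor_La v) (ext mor_La w)"
    unfolding lex_less_def by blast
  have "ext mor_Rb v = mor_Rb z @- ltr_a ## (ltr_b ## ext mor_Rb x)"
    by (simp add: zxy ext_shift ext_SCons)
  moreover have "ext mor_Rb w = mor_Rb z @- ltr_b ## ext mor_Rb y"
    by (simp add: zxy ext_shift ext_SCons)
  ultimately show "lex_less (ext mor_Rb v) (ext mor_Rb w)"
    unfolding lex_less_def by blast
qed

text \<open>A cut at a block boundary is described by an empty remainder of the preceding block.
  Thus \<open>j > 0\<close> and \<open>n > 0\<close> always hold: the remainder is a proper suffix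
  of a block, and what follows is the image of a proper suffix of \<open>w\<close>.\<close>

lemma suffix_ext:
  assumes f: "nonerasing f" and "k > 0"
  shows "\<exists>n>0. \<exists>j>0. \<exists>c. sdrop k (ext f w) = drop j (f [c]) @- ext f (sdrop n w)"
  using assms(2)
proof (induction k rule: nat_induct_non_zero)
  case 1
  have "ext f w = f [shd w] @- ext f (stl w)" by (metis ext_SCons f stream.collapse)
  moreover have "f [shd w] \<noteq> []" using f by (simp add: nonerasing_def)
  ultimately have "sdrop 1 (ext f w) = drop 1 (f [shd w]) @- ext f (sdrop 1 w)"
    by (simp add: drop_Suc)
  then show ?case by (metis zero_less_one)
next
  case (Suc k)
  then obtain n j c where *: "n > 0" "j > 0" "sdrop k (ext f w) = drop j (f [c]) @- ext f (sdrop n w)"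
    by blast
  have s: "sdrop (Suc k) (ext f w) = stl (drop j (f [c]) @- ext f (sdrop n w))"
    using *(3) by (metis sdrop_simps(2))
  show ?case
  proof (cases "drop j (f [c]) = []")
    case True
    have e: "ext f (sdrop n w) = f [w !! n] @- ext f (sdrop (Suc n) w)"
      by (metis ext_SCons f sdrop_simps stream.collapse)
    have "f [w !! n] \<noteq> []" using f by (simp add: nonerasing_def)
    then have "sdrop (Suc k) (ext f w) = drop 1 (f [w !! n]) @- ext f (sdrop (Suc n) w)"
      unfolding s True e by (simp add: drop_Suc)
    then show ?thesis by (metis zero_less_one zero_less_Suc)
  next
    case False
    then have "sdrop (Suc k) (ext f w) = drop (Suc j) (f [c]) @- ext f (sdrop n w)"
      unfolding s by (simp add: drop_Suc tl_drop)
    then show ?thesis using * by blast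
  qed
qed

lemma lyndon_ext:
  assumes w: "lyndon w" and f: "f \<in> {mor_La, mor_Rb}"
  shows "lyndon (ext f w)"
proof -
  have ne: "nonerasing f" using f by auto
  have shd: "shd (ext f w) = ltr_a"
    using w f ne by (auto simp: lyndon_def shd_ext)
  have "lex_less (ext f w) (sdrop k (ext f w))" if k: "k > 0" for k
  proof -
    obtain n j c where *: "n > 0" "j > 0" "sdrop k (ext f w) = drop j (f [c]) @- ext f (sdrop n w)"
      using suffix_ext[OF ne k] by blast
    \<comment> \<open>The blocks are a, ab for L_a and ab, b for R_b, so a proper suffix of a block
      is empty or b. In the first case the order of \<open>w\<close> and its suffix is transported,
      in the second the first letter decides.\<close>
    have "drop j (f [c]) \<in> {[], [ltr_b]}"
      using f *(2) by (cases c; cases j) (auto simp: drop_Cons' split: if_splits)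
    then show ?thesis
    proof (elim insertE)
      assume "drop j (f [c]) = []"
      moreover have "lex_less w (sdrop n w)" using w * by (simp add: lyndon_def)
      ultimately show ?thesis using * f lex_less_ext by auto
    next
      assume "drop j (f [c]) = [ltr_b]"
      moreover have "ext f w = [] @- ltr_a ## stl (ext f w)" using shd by (metis shift.simps(1) stream.collapse)
      ultimately show ?thesis using * unfolding lex_less_def
        by (metis shift.simps)
    qed simp
  qed
  then show ?thesis using shd by (simp add: lyndon_def)
qed

section \<open>Prepending the letter a to Lyndon words\<close>

lemma word_cases: "(\<exists>j. z = replicate j ltr_a) \<or> (\<exists>j t. z = replicate j ltr_a @ ltr_b # t)"
proof (induction z)
  case (Cons c z)
  show ?case
  proof (cases c)
    case ltr_a
    from Cons show ?thesis
    proof (elim disjE exE)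
      fix j assume "z = replicate j ltr_a"
      then have "c # z = replicate (Suc j) ltr_a" by (simp add: ltr_a)
      then show ?thesis by blast
    next
      fix j t assume "z = replicate j ltr_a @ ltr_b # t"
      then have "c # z = replicate (Suc j) ltr_a @ ltr_b # t" by (simp add: ltr_a)
      then show ?thesis by blast
    qed
  next
    case ltr_b
    then have "c # z = replicate 0 ltr_a @ ltr_b # z" by simp
    then show ?thesis by blast
  qed
qed simp

lemma replicate_shift_SCons: "replicate j c @- c ## w = c ## replicate j c @- w"
  by (induction j) simp_all

text \<open>An additional a in front cannot make a word larger: if the common prefix is a power of
  a, the first difference stays in place; otherwise it moves to the first b of that prefix.\<close>

lemma lex_less_SCons_a:
  assumes "lex_less v w"
  shows "lex_less (ltr_a ## v) w"
proof -
  obtain z x y where zxy: "v = z @- ltr_a ## x" "w = z @- ltr_b ## y"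
    using assms unfolding lex_less_def by blast
  from word_cases[of z] show ?thesis
  proof (elim disjE exE)
    fix j assume z: "z = replicate j ltr_a"
    have "ltr_a ## v = z @- ltr_a ## (ltr_a ## x)"
      by (simp add: zxy z replicate_shift_SCons)
    then show ?thesis using zxy unfolding lex_less_def by blast
  next
    fix j t assume z: "z = replicate j ltr_a @ ltr_b # t"
    have "ltr_a ## v = replicate j ltr_a @- ltr_a ## (ltr_b ## t @- ltr_a ## x)"
      by (simp add: zxy z replicate_shift_SCons)
    moreover have "w = replicate j ltr_a @- ltr_b ## (t @- ltr_b ## y)" by (simp add: zxy z)
    ultimately show ?thesis unfolding lex_less_def by blast
  qed
qed

lemma lyndon_SCons_a:
  assumes "lyndon w"
  shows "lyndon (ltr_a ## w)"
proof -
  \<comment> \<open>The comparison with the tail provides a b in \<open>w\<close>; at the first b,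
    the word with a prepended still shows a.\<close>
  have "lex_less w (stl w)" using assms unfolding lyndon_def by (metis sdrop.simps zero_less_one One_nat_def)
  then obtain z x y where z: "w = z @- ltr_a ## x" "stl w = z @- ltr_b ## y" unfolding lex_less_def by blast
  have w: "w = ltr_a ## stl w" using assms unfolding lyndon_def by (metis stream.collapse)
  from word_cases[of z] have "\<exists>j t. w = replicate j ltr_a @- ltr_b ## t"
  proof (elim disjE exE)
    fix j assume "z = replicate j ltr_a"
    moreover have "w = ltr_a ## z @- ltr_b ## y" using w z(2) by simp
    ultimately have "w = replicate (Suc j) ltr_a @- ltr_b ## y" by simp
    then show ?thesis by blast
  next
    fix j t assume "z = replicate j ltr_a @ ltr_b # t"
    then have "w = replicate j ltr_a @- ltr_b ## (t @- ltr_a ## x)" by (simp add: z)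
    then show ?thesis by blast
  qed
  then obtain j t where jt: "w = replicate j ltr_a @- ltr_b ## t" by blast
  then have "ltr_a ## w = replicate j ltr_a @- ltr_a ## (ltr_b ## t)" by (simp add: replicate_shift_SCons)
  with jt have base: "lex_less (ltr_a ## w) w" unfolding lex_less_def by blast
  have "lex_less (ltr_a ## w) (sdrop k (ltr_a ## w))" if "k > 0" for k
  proof (cases k)
    case (Suc m)
    then show ?thesis
      using base assms lex_less_SCons_a[of w "sdrop m w"] by (cases "m = 0") (simp_all add: lyndon_def)
  qed (use that in simp)
  then show ?thesis by (simp add: lyndon_def)
qed

lemma lyndon_comp_star: "f \<in> comp_star {mor_La, mor_Rb} \<Longrightarrow> lyndon w \<Longrightarrow> lyndon (ext f w)"
proof (induction f rule: comp_star_induct)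
  case (step s g)
  then have "nonerasing s" "nonerasing g" by (auto elim!: nonerasing_comp_star)
  then show ?case using step lyndon_ext by (simp add: ext_comp)
qed simp

text \<open>Each R_a in \<open>h\<close> consumes one leading a: \<open>h\<close> fixes a, so an
  additional a reaches R_a unchanged, and R_a(a x) = L_a(x) replaces R_a by the order-preserving
  L_a.\<close>

lemma lyndon_padding:
  assumes "h \<in> comp_star {mor_La, mor_Ra}" "lyndon w"
  shows "\<exists>m. lyndon (replicate m ltr_a @- w) \<and> lyndon (ext h (replicate m ltr_a @- w))"
  using assms(1)
proof (induction h rule: comp_star_induct)
  case id
  then show ?case using assms(2) by (intro exI[of _ 0]) simp
next
  case (step s h)
  then obtain m where m: "lyndon (replicate m ltr_a @- w)" "lyndon (ext h (replicate m ltr_a @- w))" by blast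
  have ne: "nonerasing s" "nonerasing h" using step by (auto elim!: nonerasing_comp_star)
  have ha: "h [ltr_a] = [ltr_a]" using step(2)
    by (induction h rule: comp_star_induct) (auto simp: id_apply comp_apply)
  show ?case
  proof (cases "s = mor_La")
    case True
    then show ?thesis using m ne lyndon_ext[of _ mor_La] by (intro exI[of _ m]) (simp add: ext_comp)
  next
    case False
    then have s: "s = mor_Ra" using step by simp
    have "ext (s \<circ> h) (replicate (Suc m) ltr_a @- w) = ext mor_La (ext h (replicate m ltr_a @- w))"
      using ne by (simp add: s ext_comp ext_SCons ha ext_Ra_conj)
    then have "lyndon (ext (s \<circ> h) (replicate (Suc m) ltr_a @- w))" using m(2) by (simp add: lyndon_ext)
    moreover have "lyndon (replicate (Suc m) ltr_a @- w)" using m(1) by (simp add: lyndon_SCons_a)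
    ultimately show ?thesis by blast
  qed
qed

lemma sconst_unfold: "sconst c = c ## sconst c"
  by (subst siterate.ctr) (simp add: id_apply)

text \<open>The witnesses of weak quasiperiodicity need not be Sturmian, so this ultimately periodic
  word, whose proper suffixes are all constant, can serve.\<close>

lemma lyndon_ab_omega: "lyndon (ltr_a ## sconst ltr_b)"
  unfolding lyndon_def lex_less_def
proof (intro conjI allI impI)
  fix k :: nat assume "k > 0"
  then have "sdrop k (ltr_a ## sconst ltr_b) = [] @- ltr_b ## sconst ltr_b"
    by (cases k) (simp_all add: id_apply flip: sconst_unfold)
  then show "\<exists>z x y. ltr_a ## sconst ltr_b = z @- ltr_a ## x \<and> sdrop k (ltr_a ## sconst ltr_b) = z @- ltr_b ## y"
    by (metis shift.simps(1))
qed simp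

section \<open>Weakly quasiperiodic products\<close>

lemma weakly_quasiperiodic_iff:
  assumes "nonerasing f"
  shows "weakly_quasiperiodic f \<longleftrightarrow>
    (\<exists>w. \<not> quasiperiodic w \<and> quasiperiodic (ext f w)) \<and>
    (\<exists>w. \<not> quasiperiodic w \<and> \<not> quasiperiodic (ext f w))"
  using assms by (auto simp: weakly_quasiperiodic_def inf_image_ext nonerasing_def)

lemma weakly_quasiperiodic_E_comp:
  assumes "nonerasing f"
  shows "weakly_quasiperiodic (mor_E \<circ> f) \<longleftrightarrow> weakly_quasiperiodic f"
  using assms by (simp add: weakly_quasiperiodic_iff nonerasing_comp ext_comp)

lemma weakly_quasiperiodic_comp_E:
  assumes "nonerasing f" "weakly_quasiperiodic f"
  shows "weakly_quasiperiodic (f \<circ> mor_E)"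
  using assms unfolding weakly_quasiperiodic_iff[OF assms(1)]
  by (simp add: weakly_quasiperiodic_iff nonerasing_comp ext_comp) (metis ext_E_E quasiperiodic_ext_E)

text \<open>For R_a, the witness a b b b ... is fixed by R_b, so its image is also its image under
  R_a R_b; R_b follows by exchange. For L_a, any non-quasiperiodic word of the form L_b(x) will
  do.\<close>

lemma generator_weakens:
  assumes "s \<in> {mor_La, mor_Ra, mor_Rb}"
  shows "\<exists>w. \<not> quasiperiodic w \<and> quasiperiodic (ext s w)"
proof -
  have Ra: "\<not> quasiperiodic (ltr_a ## sconst ltr_b) \<and> quasiperiodic (ext mor_Ra (ltr_a ## sconst ltr_b))"
  proof
    have "ext mor_Rb (sconst ltr_b) = sconst ltr_b"
    proof (rule stream_eqI)
      \<comment> \<open>L_b and R_b agree on the letter b. By \<open>ext_Rb_conj\<close> the image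
        therefore equals itself with a b in front, so it is constant.\<close>
      have "ext mor_Lb (sconst ltr_b) = ext mor_Rb (sconst ltr_b)"
        unfolding ext_def by (intro arg_cong[of _ _ flat] stream.map_cong) auto
      then have "ltr_b ## ext mor_Rb (sconst ltr_b) = ext mor_Rb (sconst ltr_b)"
        by (simp add: ext_Rb_conj)
      then have "ext mor_Rb (sconst ltr_b) !! n = ltr_b" for n
        by (induction n) (metis snth.simps(1) stream.sel(1), metis snth_Stream)
      then show "ext mor_Rb (sconst ltr_b) !! n = sconst ltr_b !! n" for n by (simp add: id_apply)
    qed
    then have "ext mor_Rb (ltr_a ## sconst ltr_b) = ltr_a ## sconst ltr_b"
      by (simp add: ext_SCons flip: sconst_unfold)
    then show "quasiperiodic (ext mor_Ra (ltr_a ## sconst ltr_b))"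
      using quasiperiodic_Ra_Rb[of "ltr_a ## sconst ltr_b"] by simp
  qed (simp add: lyndon_ab_omega lyndon_not_quasiperiodic)
  have Rb: "\<exists>w. \<not> quasiperiodic w \<and> quasiperiodic (ext mor_Rb w)"
    using Ra ext_E_conj(3) by (metis quasiperiodic_ext_E)
  \<comment> \<open>Exchanging letters makes this a non-quasiperiodic word in the image of
    L_b.\<close>
  have "lyndon (ext mor_La (ltr_a ## sconst ltr_b))" by (simp add: lyndon_ab_omega lyndon_ext)
  then have "\<not> quasiperiodic (ext mor_E (ext mor_La (ltr_a ## sconst ltr_b)))"
    by (simp add: lyndon_not_quasiperiodic)
  then have "\<exists>w. \<not> quasiperiodic w \<and> quasiperiodic (ext mor_La w)"
    using quasiperiodic_La_Lb unfolding ext_E_conj by blast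
  then show ?thesis using Ra Rb assms by blast
qed

lemma weakly_quasiperiodic_a_type:
  assumes "f \<in> a_type" "f \<noteq> id"
  shows "weakly_quasiperiodic f"
proof -
  obtain g h where f: "f = g \<circ> h" and g: "g \<in> comp_star {mor_La, mor_Rb}"
    and h: "h \<in> comp_star {mor_La, mor_Ra}"
    using assms(1) by (auto simp: comp_set_def)
  have ne: "nonerasing f" "nonerasing g" "nonerasing h"
    using nonerasing_a_type[OF assms(1)] g h by (auto elim!: nonerasing_comp_star)
  obtain m where m: "lyndon (replicate m ltr_a @- ltr_a ## sconst ltr_b)"
      "lyndon (ext h (replicate m ltr_a @- ltr_a ## sconst ltr_b))"
    using lyndon_padding[OF h lyndon_ab_omega] by blast
  then have "lyndon (ext f (replicate m ltr_a @- ltr_a ## sconst ltr_b))"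
    using lyndon_comp_star[OF g] ne by (simp add: f ext_comp)
  then have 1: "\<exists>w. \<not> quasiperiodic w \<and> \<not> quasiperiodic (ext f w)"
    using m lyndon_not_quasiperiodic by blast
  have "\<exists>k s. nonerasing k \<and> s \<in> {mor_La, mor_Ra, mor_Rb} \<and> f = k \<circ> s"
  proof (cases "h = id")
    case True
    then have "g \<noteq> id" using assms(2) f by simp
    then obtain k s where "k \<in> comp_star {mor_La, mor_Rb}" "s \<in> {mor_La, mor_Rb}" "g = k \<circ> s"
      using comp_star_snoc_cases[OF g] by blast
    moreover from this have "nonerasing k" by (auto elim!: nonerasing_comp_star)
    ultimately show ?thesis using True f by auto
  next
    case False
    then obtain k s where "k \<in> comp_star {mor_La, mor_Ra}" "s \<in> {mor_La, mor_Ra}" "h = k \<circ> s"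
      using comp_star_snoc_cases[OF h] by blast
    moreover from this have "nonerasing k" by (auto elim!: nonerasing_comp_star)
    ultimately show ?thesis using f ne by (metis comp_assoc insertCI insertE nonerasing_comp singletonD)
  qed
  then obtain k s where k: "nonerasing k" "s \<in> {mor_La, mor_Ra, mor_Rb}" "f = k \<circ> s" by blast
  then have "nonerasing s" by auto
  then have 2: "\<exists>w. \<not> quasiperiodic w \<and> quasiperiodic (ext f w)"
    using generator_weakens[OF k(2)] k(1) unfolding k(3) by (metis ext_comp quasiperiodic_ext)
  show ?thesis using 1 2 by (simp add: weakly_quasiperiodic_iff ne)
qed

lemma weakly_quasiperiodic_b_type:
  assumes "f \<in> b_type" "f \<noteq> id"
  shows "weakly_quasiperiodic f"
proof -
  have "conj_E f \<in> a_type" "conj_E f \<noteq> id"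
    using assms conj_E_b_type by (auto dest: arg_cong[of _ _ conj_E])
  then have "weakly_quasiperiodic (conj_E f)" "nonerasing (conj_E f)"
    using weakly_quasiperiodic_a_type nonerasing_a_type by blast+
  then have "weakly_quasiperiodic (conj_E f \<circ> mor_E)" "nonerasing (conj_E f \<circ> mor_E)"
    by (simp_all add: weakly_quasiperiodic_comp_E nonerasing_comp)
  then have "weakly_quasiperiodic (mor_E \<circ> (conj_E f \<circ> mor_E))"
    by (simp add: weakly_quasiperiodic_E_comp)
  then show ?thesis by (metis conj_E_conj_E conj_E_def comp_assoc)
qed

section \<open>Factors and balance\<close>

lemma factor_of_inf_iff: "factor_of_inf u w \<longleftrightarrow> (\<exists>x t. w = x @- u @- t)"
proof
  assume "factor_of_inf u w"
  then obtain n t where "sdrop n w = u @- t" by (auto simp: factor_of_inf_def prefix_of_inf_iff)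
  then show "\<exists>x t. w = x @- u @- t" by (metis stake_sdrop)
next
  assume "\<exists>x t. w = x @- u @- t"
  then obtain x t where "w = x @- u @- t" by blast
  then show "factor_of_inf u w"
    by (auto simp: factor_of_inf_def prefix_of_inf_iff sdrop_shift intro!: exI[of _ "length x"])
qed

lemma factor_sublist: "factor_of_inf v w \<Longrightarrow> sublist u v \<Longrightarrow> factor_of_inf u w"
  unfolding factor_of_inf_iff sublist_def by (metis shift_append)

lemma factor_ext: "nonerasing f \<Longrightarrow> factor_of_inf u w \<Longrightarrow> factor_of_inf (f u) (ext f w)"
  unfolding factor_of_inf_iff by (metis ext_shift)

lemma count_letters: "count_list u ltr_a + count_list u ltr_b = length u"
proof (induction u)
  case (Cons c u) then show ?case by (cases c) auto
qed simp

lemma count_list_le_length: "count_list u c \<le> length u"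
  by (induction u) auto

text \<open>Counting b suits the descent because L_a and R_a keep the number of b; the one-sided
  bound suffices because \<open>u\<close> and \<open>v\<close> may be exchanged.\<close>

lemma balanced_iff:
  "balanced w \<longleftrightarrow> (\<forall>u v. factor_of_inf u w \<and> factor_of_inf v w \<and> length u = length v
      \<longrightarrow> count_list u ltr_b \<le> count_list v ltr_b + 1)"
proof -
  have "\<bar>int (count_list u ltr_a) - int (count_list v ltr_a)\<bar> \<le> 1 \<longleftrightarrow>
      count_list u ltr_b \<le> count_list v ltr_b + 1 \<and> count_list v ltr_b \<le> count_list u ltr_b + 1"
    if "length u = length v" for u v
    using that count_letters[of u] count_letters[of v] by linarith
  then show ?thesis unfolding balanced_def by metis
qed

lemma balanced_b_le:
  "balanced w \<Longrightarrow> factor_of_inf u w \<Longrightarrow> factor_of_inf v w \<Longrightarrow> length u = length v \<Longrightarrow>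
    count_list u ltr_b \<le> count_list v ltr_b + 1"
  by (simp add: balanced_iff)

lemma balanced_not_aa_bb:
  "balanced w \<Longrightarrow> \<not> factor_of_inf [ltr_a, ltr_a] w \<or> \<not> factor_of_inf [ltr_b, ltr_b] w"
  using balanced_b_le[of w "[ltr_b, ltr_b]" "[ltr_a, ltr_a]"] by auto

lemma count_ext_E: "count_list (mor_E u) ltr_b = count_list u ltr_a" "length (mor_E u) = length u"
proof (induction u)
  case (Cons c u)
  { case 1 then show ?case using Cons by (cases c) (simp_all add: generator_Cons) }
  { case 2 then show ?case using Cons by (cases c) (simp_all add: generator_Cons) }
qed simp_all

lemma factor_E: "factor_of_inf u (ext mor_E w) \<Longrightarrow> factor_of_inf (mor_E u) w"
  using factor_ext[of mor_E u "ext mor_E w"] by simp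

lemma balanced_ext_E:
  assumes "balanced w"
  shows "balanced (ext mor_E w)"
  unfolding balanced_iff
proof (intro allI impI, elim conjE)
  fix u v assume *: "factor_of_inf u (ext mor_E w)" "factor_of_inf v (ext mor_E w)" "length u = length v"
  then have "count_list (mor_E v) ltr_b \<le> count_list (mor_E u) ltr_b + 1"
    using assms factor_E by (intro balanced_b_le) (auto simp: count_ext_E)
  then show "count_list u ltr_b \<le> count_list v ltr_b + 1"
    using *(3) count_letters[of u] count_letters[of v] by (simp add: count_ext_E)
qed

lemma count_La: "count_list (mor_La u) ltr_b = count_list u ltr_b"
  "length (mor_La u) = length u + count_list u ltr_b"
proof (induction u)
  case (Cons c u)
  { case 1 then show ?case using Cons by (cases c) (simp_all add: generator_Cons) }
  { case 2 then show ?case using Cons by (cases c) (simp_all add: generator_Cons) }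
qed simp_all

lemma length_Ra: "length (mor_Ra u) = length u + count_list u ltr_b"
  using arg_cong[OF a_Ra_eq_La_a[of u], of length] by (simp add: count_La)

text \<open>Both \<open>L_a\<close> and \<open>R_a\<close> are covered: \<open>a R_a(v) = L_a(v) a\<close>, and removing the outer \<open>a\<close> from
  \<open>L_a(u)\<close> or from \<open>R_a(u)\<close> leaves the same word \<open>U\<close>.\<close>

lemma balanced_desubstitute:
  assumes w: "balanced w"
    and long: "\<And>v. factor_of_inf v y \<Longrightarrow> factor_of_inf (mor_La v @ [ltr_a]) w"
    and short: "\<And>U u. factor_of_inf u y \<Longrightarrow> ltr_a # U = mor_La u \<Longrightarrow> factor_of_inf U w"
  shows "balanced y"
  unfolding balanced_iff
proof (intro allI impI, elim conjE, rule ccontr)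
  fix u v assume uv: "factor_of_inf u y" "factor_of_inf v y" "length u = length v"
    and "\<not> count_list u ltr_b \<le> count_list v ltr_b + 1"
  then have gap: "count_list u ltr_b \<ge> count_list v ltr_b + 2" by simp
  then obtain c t where ct: "u = c # t" by (cases u) auto
  have "\<exists>U. ltr_a # U = mor_La u" unfolding ct by (cases c) (simp_all add: morphism_Cons[of mor_La _ t])
  then obtain U where U: "ltr_a # U = mor_La u" by blast
  let ?V = "mor_La v @ [ltr_a]"
  have lenU: "Suc (length U) = length u + count_list u ltr_b"
    using arg_cong[OF U, of length] by (simp add: count_La)
  have cU: "count_list U ltr_b = count_list u ltr_b"
    using arg_cong[OF U, of "\<lambda>x. count_list x ltr_b"] by (simp add: count_La)
  have lenV: "length ?V = length u + count_list v ltr_b + 1" using uv(3) by (simp add: count_La)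
  \<comment> \<open>\<open>U\<close> is longer than \<open>?V\<close> by exactly the excess of the
    gap over 2. Each letter cut off removes at most one b, so a surplus of two survives the
    truncation.\<close>
  let ?U = "take (length ?V) U"
  have "factor_of_inf U w" using short uv(1) U by blast
  then have 1: "factor_of_inf ?U w" using factor_sublist sublist_take by blast
  have 2: "factor_of_inf ?V w" using long uv(2) by blast
  have lenU': "length ?U = length ?V" using gap lenU lenV by simp
  have "count_list U ltr_b = count_list ?U ltr_b + count_list (drop (length ?V) U) ltr_b"
    by (metis append_take_drop_id count_list_append)
  then have "count_list U ltr_b \<le> count_list ?U ltr_b + (length U - length ?V)"
    using count_list_le_length[of "drop (length ?V) U" ltr_b] by simp
  then have "count_list ?V ltr_b + 2 \<le> count_list ?U ltr_b"
    using cU lenU lenV gap by (simp add: count_La)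
  then show False using balanced_b_le[OF w 1 2 lenU'] by simp
qed

text \<open>The a behind L_a(v) is the first letter of the image of what follows
  \<open>v\<close>.\<close>

lemma balanced_ext_La_D:
  assumes "balanced (ext mor_La y)"
  shows "balanced y"
proof (rule balanced_desubstitute[OF assms])
  fix v assume "factor_of_inf v y"
  then obtain x t where "y = x @- v @- t" by (auto simp: factor_of_inf_iff)
  then have "ext mor_La y = mor_La x @- (mor_La v @ [ltr_a]) @- ext mor_Ra t"
    by (simp add: ext_shift ext_Ra_conj)
  then show "factor_of_inf (mor_La v @ [ltr_a]) (ext mor_La y)"
    unfolding factor_of_inf_iff by blast
next
  fix U u assume "factor_of_inf u y" "ltr_a # U = mor_La u"
  then show "factor_of_inf U (ext mor_La y)"
    using factor_sublist[OF factor_ext[of mor_La u y], of U] by (metis nonerasing_generator(2) sublist_Cons_right sublist_order.order_refl)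
qed

text \<open>The a before R_a(v) must come from the image of a preceding letter, which
  \<open>p\<close> guarantees. Without left context the claim fails: R_a sends the unbalanced a a b
  b b ... to the balanced a a b a b a ...\<close>

lemma balanced_ext_Ra_D:
  assumes bal: "balanced (ext mor_Ra (p @- y))" and p: "p \<noteq> []"
  shows "balanced y"
proof (rule balanced_desubstitute[OF bal])
  fix v assume "factor_of_inf v y"
  then obtain x t where y: "y = x @- v @- t" by (auto simp: factor_of_inf_iff)
  have "\<exists>q. mor_Ra (p @ x) = q @ [ltr_a]"
  proof -
    obtain q c where "p @ x = q @ [c]" using p by (metis append_is_Nil_conv rev_exhaust)
    then have "mor_Ra (p @ x) = mor_Ra q @ mor_Ra [c]" by (simp add: morphism_append)
    then show ?thesis by (cases c) auto
  qed
  then obtain q where q: "mor_Ra (p @ x) = q @ [ltr_a]" by blast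
  have "ext mor_Ra (p @- y) = mor_Ra (p @ x) @- mor_Ra v @- ext mor_Ra t"
  proof -
    have "p @- y = (p @ x) @- v @- t" by (simp add: y)
    then show ?thesis by (simp only: ext_shift nonerasing_generator)
  qed
  then have "ext mor_Ra (p @- y) = q @- (ltr_a # mor_Ra v) @- ext mor_Ra t"
    by (simp add: q)
  then show "factor_of_inf (mor_La v @ [ltr_a]) (ext mor_Ra (p @- y))"
    unfolding factor_of_inf_iff a_Ra_eq_La_a by blast
next
  fix U u assume u: "factor_of_inf u y" "ltr_a # U = mor_La u"
  have "ltr_a # mor_Ra u = ltr_a # U @ [ltr_a]" using u(2) by (simp add: a_Ra_eq_La_a flip: append_Cons)
  then have Ra: "mor_Ra u = U @ [ltr_a]" by simp
  have "factor_of_inf u (p @- y)" using u(1) unfolding factor_of_inf_iff by (metis shift_append)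
  then have "factor_of_inf (U @ [ltr_a]) (ext mor_Ra (p @- y))"
    using factor_ext[of mor_Ra u] Ra by simp
  then show "factor_of_inf U (ext mor_Ra (p @- y))"
    using factor_sublist by blast
qed

section \<open>Ultimate periodicity\<close>

lemma eq_cycleI:
  assumes "w = u @- w" "u \<noteq> []"
  shows "w = cycle u"
proof (rule stream_eqI)
  fix n show "w !! n = cycle u !! n"
  proof (induction n rule: less_induct)
    case (less n)
    have "w !! n = (if n < length u then u ! n else w !! (n - length u))"
      using shift_snth[of u w n] assms(1) by simp
    moreover have "cycle u !! n = (if n < length u then u ! n else cycle u !! (n - length u))"
      using shift_snth[of u "cycle u" n] cycle_decomp[OF assms(2)] by simp
    moreover have "w !! (n - length u) = cycle u !! (n - length u)" if "\<not> n < length u"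
      using less[of "n - length u"] that assms(2) by (cases u) auto
    ultimately show ?case by simp
  qed
qed

lemma ultimately_periodicI: "w = u @- w \<Longrightarrow> u \<noteq> [] \<Longrightarrow> ultimately_periodic w"
  unfolding ultimately_periodic_def by (metis eq_cycleI shift.simps(1))

lemma ultimately_periodic_ext:
  assumes "nonerasing f" "ultimately_periodic w"
  shows "ultimately_periodic (ext f w)"
proof -
  obtain u v where v: "v \<noteq> []" "w = u @- cycle v" using assms(2) by (auto simp: ultimately_periodic_def)
  have fv: "f v \<noteq> []" using nonerasing_length[OF assms(1), of v] v(1) by auto
  have "ext f (cycle v) = f v @- ext f (cycle v)"
    using cycle_decomp[OF v(1)] ext_shift[OF assms(1)] by metis
  then have "ext f w = f u @- cycle (f v)"
    using eq_cycleI fv assms(1) v(2) by (simp add: ext_shift)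
  then show ?thesis using fv by (auto simp: ultimately_periodic_def)
qed

lemma sturmian_ext_E: "sturmian w \<Longrightarrow> sturmian (ext mor_E w)"
  unfolding sturmian_def using balanced_ext_E ultimately_periodic_ext[of mor_E "ext mor_E w"] by auto

section \<open>Mechanical words\<close>

text \<open>The lower mechanical word: b marks the jumps of the floor, so the slope is the frequency
  of b. A shift adds the slope to the intercept, so with all real intercepts the family is closed
  under some left extension.\<close>

definition mechanical :: "real \<Rightarrow> real \<Rightarrow> infword" where
  "mechanical \<alpha> \<rho> = smap (\<lambda>n. if \<lfloor>real (Suc n) * \<alpha> + \<rho>\<rfloor> = \<lfloor>real n * \<alpha> + \<rho>\<rfloor> then ltr_a else ltr_b) (fromN 0)"

lemma mechanical_snth:
  "mechanical \<alpha> \<rho> !! n = (if \<lfloor>real (Suc n) * \<alpha> + \<rho>\<rfloor> = \<lfloor>real n * \<alpha> + \<rho>\<rfloor> then ltr_a else ltr_b)"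
  by (simp add: mechanical_def)

lemma stl_mechanical: "stl (mechanical \<alpha> \<rho>) = mechanical \<alpha> (\<rho> + \<alpha>)"
proof (rule stream_eqI)
  fix n
  have "stl (mechanical \<alpha> \<rho>) !! n = mechanical \<alpha> \<rho> !! Suc n" by simp
  then show "stl (mechanical \<alpha> \<rho>) !! n = mechanical \<alpha> (\<rho> + \<alpha>) !! n"
    unfolding mechanical_snth by (simp add: algebra_simps)
qed

text \<open>A slope between 0 and 1 makes each floor increment 0 or 1, so counting b is a
  telescoping sum.\<close>

lemma count_mechanical:
  assumes "0 < \<alpha>" "\<alpha> < 1"
  shows "int (count_list (stake L (sdrop n (mechanical \<alpha> \<rho>))) ltr_b) =
    \<lfloor>real (n + L) * \<alpha> + \<rho>\<rfloor> - \<lfloor>real n * \<alpha> + \<rho>\<rfloor>"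
proof (induction L)
  case (Suc L)
  have step: "\<lfloor>real (Suc m) * \<alpha> + \<rho>\<rfloor> = \<lfloor>real m * \<alpha> + \<rho>\<rfloor> \<or>
      \<lfloor>real (Suc m) * \<alpha> + \<rho>\<rfloor> = \<lfloor>real m * \<alpha> + \<rho>\<rfloor> + 1" for m
  proof -
    have "real (Suc m) * \<alpha> + \<rho> = (real m * \<alpha> + \<rho>) + \<alpha>" by (simp add: algebra_simps)
    then show ?thesis using assms by linarith
  qed
  have "stake (Suc L) (sdrop n (mechanical \<alpha> \<rho>)) =
      stake L (sdrop n (mechanical \<alpha> \<rho>)) @ [mechanical \<alpha> \<rho> !! (n + L)]"
    by (simp add: stake_Suc sdrop_snth del: stake.simps)
  then show ?case using Suc step[of "n + L"]
    by (auto simp: mechanical_snth simp del: stake.simps of_nat_Suc of_nat_add)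
qed simp

text \<open>For fixed c, the difference floor(x + c) - floor(x) is floor(c) or floor(c) + 1,
  whatever x is.\<close>

lemma balanced_mechanical:
  assumes "0 < \<alpha>" "\<alpha> < 1"
  shows "balanced (mechanical \<alpha> \<rho>)"
  unfolding balanced_iff
proof (intro allI impI, elim conjE)
  fix u v assume *: "factor_of_inf u (mechanical \<alpha> \<rho>)" "factor_of_inf v (mechanical \<alpha> \<rho>)"
    "length u = length v"
  then obtain m n where "stake (length v) (sdrop m (mechanical \<alpha> \<rho>)) = u"
    "stake (length v) (sdrop n (mechanical \<alpha> \<rho>)) = v"
    by (auto simp: factor_of_inf_def prefix_of_inf_def)
  then have c: "int (count_list u ltr_b) = \<lfloor>real (m + length v) * \<alpha> + \<rho>\<rfloor> - \<lfloor>real m * \<alpha> + \<rho>\<rfloor>"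
    "int (count_list v ltr_b) = \<lfloor>real (n + length v) * \<alpha> + \<rho>\<rfloor> - \<lfloor>real n * \<alpha> + \<rho>\<rfloor>"
    using count_mechanical[OF assms] by metis+
  have e: "real (k + length v) * \<alpha> + \<rho> = (real k * \<alpha> + \<rho>) + real (length v) * \<alpha>" for k
    by (simp add: algebra_simps)
  show "count_list u ltr_b \<le> count_list v ltr_b + 1"
    using c unfolding e by linarith
qed

text \<open>If the period has length \<open>p\<close> and contains \<open>k\<close> letters b, the
  floor grows by exactly \<open>k\<close> per period. Then t(p\<alpha> - k) stays below 1 in
  absolute value for every t, which forces \<alpha> = k/p.\<close>

lemma not_ultimately_periodic_mechanical:
  assumes \<alpha>: "0 < \<alpha>" "\<alpha> < 1" and irr: "\<alpha> \<notin> \<rat>"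
  shows "\<not> ultimately_periodic (mechanical \<alpha> \<rho>)"
proof
  assume "ultimately_periodic (mechanical \<alpha> \<rho>)"
  then obtain u v where v: "v \<noteq> []" "mechanical \<alpha> \<rho> = u @- cycle v"
    by (auto simp: ultimately_periodic_def)
  define N p k where "N = length u" and "p = length v" and "k = count_list v ltr_b"
  have drop: "sdrop (N + t * p) (mechanical \<alpha> \<rho>) = cycle v" for t
  proof (induction t)
    case 0 then show ?case by (simp add: v(2) N_def sdrop_shift)
  next
    case (Suc t)
    have "sdrop p (cycle v) = cycle v"
      by (subst cycle_decomp[OF v(1)]) (simp add: p_def sdrop_shift)
    then show ?case using Suc
      by (metis (no_types, lifting) add.assoc add.commute mult_Suc sdrop_add)
  qed
  have stk: "stake p (cycle v) = v"
    by (subst cycle_decomp[OF v(1)]) (simp add: p_def stake_shift)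
  have step: "\<lfloor>real (N + t * p + p) * \<alpha> + \<rho>\<rfloor> = \<lfloor>real (N + t * p) * \<alpha> + \<rho>\<rfloor> + int k" for t
    using count_mechanical[OF \<alpha>, where n = "N + t * p" and L = p and \<rho> = \<rho>]
    by (simp add: drop stk k_def)
  have fl: "\<lfloor>real (N + t * p) * \<alpha> + \<rho>\<rfloor> = \<lfloor>real N * \<alpha> + \<rho>\<rfloor> + int t * int k" for t
  proof (induction t)
    case (Suc t)
    have "N + Suc t * p = N + t * p + p" by simp
    then show ?case using step[of t] Suc by (simp only:) (simp add: algebra_simps)
  qed simp
  define \<delta> where "\<delta> = real p * \<alpha> - real k"
  have bound: "\<bar>real t * \<delta>\<bar> < 1" for t
  proof -
    have e: "real (N + t * p) * \<alpha> + \<rho> = (real N * \<alpha> + \<rho>) + real t * \<delta> + real (t * k)"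
      by (simp add: \<delta>_def algebra_simps)
    have "\<lfloor>real (N + t * p) * \<alpha> + \<rho>\<rfloor> = \<lfloor>real N * \<alpha> + \<rho>\<rfloor> + int (t * k)" using fl by simp
    then show ?thesis unfolding e by linarith
  qed
  have "\<delta> = 0"
  proof (rule ccontr)
    assume "\<delta> \<noteq> 0"
    then obtain t where "1 < real t * \<bar>\<delta>\<bar>" using reals_Archimedean3[of "\<bar>\<delta>\<bar>"] by auto
    then show False using bound[of t] by (simp add: abs_mult)
  qed
  moreover have "p > 0" using v(1) by (simp add: p_def)
  ultimately have "\<alpha> = real k / real p" by (simp add: \<delta>_def field_simps)
  then show False using irr by simp
qed

text \<open>Left extendability is needed to desubstitute \<open>R_a\<close>, whose preimages lose a letter at the start.\<close>

definition test_set :: "infword set \<Rightarrow> bool" where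
  "test_set S \<longleftrightarrow> (\<forall>w\<in>S. sturmian w \<and> (\<exists>c. c ## w \<in> S)) \<and>
     (\<exists>x\<in>S. factor_of_inf [ltr_a, ltr_a, ltr_a] x \<and> factor_of_inf [ltr_a, ltr_b, ltr_a] x) \<and>
     (\<exists>x\<in>S. factor_of_inf [ltr_b, ltr_b, ltr_b] x \<and> factor_of_inf [ltr_b, ltr_a, ltr_b] x)"

text \<open>For a slope between 1/5 and 1/4 the first jump of the floor from intercept 0 is at the
  fifth letter, giving the prefix aaaaba. It contains aaa and aba; its exchanged copy contains bbb
  and bab. An irrational slope exists because the interval is uncountable.\<close>

lemma test_set_exists: "\<exists>S. test_set S"
proof -
  have "\<not> {1/5<..<1/4::real} \<subseteq> \<rat>"
    using uncountable_open_interval[of "1/5" "1/4"] countable_subset[OF _ countable_rat] by auto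
  then obtain \<alpha> :: real where "\<alpha> \<in> {1/5<..<1/4}" "\<alpha> \<notin> \<rat>" by blast
  then have \<alpha>: "1/5 < \<alpha>" "\<alpha> < 1/4" "\<alpha> \<notin> \<rat>" by simp_all
  define S where "S = range (mechanical \<alpha>) \<union> ext mor_E ` range (mechanical \<alpha>)"
  have st: "sturmian (mechanical \<alpha> \<rho>)" for \<rho>
    using \<alpha> by (simp add: sturmian_def balanced_mechanical not_ultimately_periodic_mechanical)
  have ex: "\<exists>c. mechanical \<alpha> (\<rho> - \<alpha>) = c ## mechanical \<alpha> \<rho>" for \<rho>
    using stl_mechanical[of \<alpha> "\<rho> - \<alpha>"] by (metis diff_add_cancel stream.collapse)
  have "\<forall>w\<in>S. sturmian w" using st by (auto simp: S_def sturmian_ext_E)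
  moreover have "\<exists>c. c ## w \<in> S" if "w \<in> S" for w
  proof -
    consider \<rho> where "w = mechanical \<alpha> \<rho>" | \<rho> where "w = ext mor_E (mechanical \<alpha> \<rho>)"
      using \<open>w \<in> S\<close> by (auto simp: S_def)
    then show ?thesis
    proof cases
      case 1
      then show ?thesis using ex[of \<rho>] by (metis S_def UnI1 rangeI)
    next
      case 2
      obtain c where c: "mechanical \<alpha> (\<rho> - \<alpha>) = c ## mechanical \<alpha> \<rho>" using ex by blast
      have "\<exists>d. ext mor_E (mechanical \<alpha> (\<rho> - \<alpha>)) = d ## w" unfolding c 2 by (cases c) auto
      then show ?thesis by (metis S_def UnI2 imageI rangeI)
    qed
  qed
  moreover have "\<exists>x\<in>S. \<exists>t. x = [ltr_a, ltr_a, ltr_a, ltr_a, ltr_b, ltr_a] @- t"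
  proof -
    have f: "\<lfloor>\<alpha>\<rfloor> = 0" "\<lfloor>2 * \<alpha>\<rfloor> = 0" "\<lfloor>3 * \<alpha>\<rfloor> = 0" "\<lfloor>4 * \<alpha>\<rfloor> = 0" "\<lfloor>5 * \<alpha>\<rfloor> = 1" "\<lfloor>6 * \<alpha>\<rfloor> = 1"
      using \<alpha> by (simp_all add: floor_eq_iff)
    let ?m = "\<lambda>n. mechanical \<alpha> 0 !! n"
    have "?m 0 = ltr_a" "?m 1 = ltr_a" "?m 2 = ltr_a" "?m 3 = ltr_a" "?m 4 = ltr_b" "?m 5 = ltr_a"
      unfolding mechanical_snth using f by simp_all
    then have "stake 6 (mechanical \<alpha> 0) = [ltr_a, ltr_a, ltr_a, ltr_a, ltr_b, ltr_a]"
      by (simp add: eval_nat_numeral)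
    then have "mechanical \<alpha> 0 = [ltr_a, ltr_a, ltr_a, ltr_a, ltr_b, ltr_a] @- sdrop 6 (mechanical \<alpha> 0)"
      by (metis stake_sdrop)
    then show ?thesis by (metis S_def UnI1 rangeI)
  qed
  moreover have "ext mor_E w \<in> S" if "w \<in> S" for w using that by (auto simp: S_def)
  ultimately have S: "\<forall>w\<in>S. sturmian w \<and> (\<exists>c. c ## w \<in> S)"
    "\<exists>x\<in>S. \<exists>t. x = [ltr_a, ltr_a, ltr_a, ltr_a, ltr_b, ltr_a] @- t"
    "\<exists>x\<in>S. \<exists>t. x = [ltr_b, ltr_b, ltr_b, ltr_b, ltr_a, ltr_b] @- t"
    by - (blast, blast, fastforce)
  have a: "factor_of_inf [c, c, c] ([c, c, c, c, d, c] @- t)"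
    "factor_of_inf [c, d, c] ([c, c, c, c, d, c] @- t)" for c d t
  proof -
    have "[c, c, c, c, d, c] @- t = [] @- [c, c, c] @- ([c, d, c] @- t)" by simp
    then show "factor_of_inf [c, c, c] ([c, c, c, c, d, c] @- t)" unfolding factor_of_inf_iff by blast
    have "[c, c, c, c, d, c] @- t = [c, c, c] @- [c, d, c] @- t" by simp
    then show "factor_of_inf [c, d, c] ([c, c, c, c, d, c] @- t)" unfolding factor_of_inf_iff by blast
  qed
  have "test_set S" unfolding test_set_def using S a by blast
  then show ?thesis by blast
qed

section \<open>Sturmian morphisms are products of generators\<close>

text \<open>The word is cut before each a: every b has an a on its left, so the pieces are a and ab.
  For R_a the cuts are made after each a.\<close>

lemma La_preimage: "\<not> sublist [ltr_b, ltr_b] u \<Longrightarrow> u = [] \<or> hd u = ltr_a \<Longrightarrow> \<exists>v. u = mor_La v"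
proof (induction u rule: induct_list012)
  case 1 then show ?case by (intro exI[of _ "[]"]) simp
next
  case (2 x) then show ?case by (intro exI[of _ "[ltr_a]"]) simp
next
  case (3 x y zs)
  show ?case
  proof (cases y)
    case ltr_a
    then obtain v where "y # zs = mor_La v" using 3 by (auto simp: sublist_Cons_right)
    then have "x # y # zs = mor_La (ltr_a # v)" using 3(4) by (simp add: morphism_Cons[of mor_La _ v])
    then show ?thesis by blast
  next
    case ltr_b
    then have "zs = [] \<or> hd zs = ltr_a" using 3(3)
      by (cases zs) (auto simp: sublist_Cons_right intro: letter.exhaust)
    then obtain v where "zs = mor_La v" using 3 by (auto simp: sublist_Cons_right)
    then have "x # y # zs = mor_La (ltr_b # v)" using 3(4) ltr_b by (simp add: morphism_Cons[of mor_La _ v])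
    then show ?thesis by blast
  qed
qed

lemma Ra_preimage: "\<not> sublist [ltr_b, ltr_b] u \<Longrightarrow> u = [] \<or> last u = ltr_a \<Longrightarrow> \<exists>v. u = mor_Ra v"
proof (induction u rule: induct_list012)
  case 1 then show ?case by (intro exI[of _ "[]"]) simp
next
  case (2 x) then show ?case by (intro exI[of _ "[ltr_a]"]) simp
next
  case (3 x y zs)
  show ?case
  proof (cases x)
    case ltr_a
    then obtain v where "y # zs = mor_Ra v" using 3 by (auto simp: sublist_Cons_right)
    then have "x # y # zs = mor_Ra (ltr_a # v)" using ltr_a by (simp add: morphism_Cons[of mor_Ra _ v])
    then show ?thesis by blast
  next
    case ltr_b
    then have y: "y = ltr_a" using 3(3) by (cases y) (auto simp: sublist_Cons_right)
    have "zs = [] \<or> last zs = ltr_a" using 3(4) by (auto split: if_splits)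
    then obtain v where "zs = mor_Ra v" using 3 by (auto simp: sublist_Cons_right)
    then have "x # y # zs = mor_Ra (ltr_b # v)" using ltr_b y by (simp add: morphism_Cons[of mor_Ra _ v])
    then show ?thesis by blast
  qed
qed

text \<open>Only words of \<open>S\<close> are tested, so that the property passes from s g to g: in
  the case of R_a the left extension of the word within \<open>S\<close> is used.\<close>

definition preserves_sturmian :: "infword set \<Rightarrow> (word \<Rightarrow> word) \<Rightarrow> bool" where
  "preserves_sturmian S f \<longleftrightarrow> nonerasing f \<and> (\<forall>w\<in>S. sturmian (ext f w))"

definition image_length :: "(word \<Rightarrow> word) \<Rightarrow> nat" where
  "image_length f = length (f [ltr_a]) + length (f [ltr_b])"

lemma image_length_E: "image_length (mor_E \<circ> f) = image_length f"
  by (simp add: image_length_def count_ext_E comp_apply)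

lemma preserves_sturmian_E: "preserves_sturmian S f \<Longrightarrow> preserves_sturmian S (mor_E \<circ> f)"
  by (simp add: preserves_sturmian_def nonerasing_comp ext_comp sturmian_ext_E)

lemma sublist_junction:
  assumes "u \<noteq> []" "v \<noteq> []" "last u = hd v"
  shows "sublist [hd v, hd v] (u @ v)"
proof -
  have "u @ v = butlast u @ [hd v, hd v] @ tl v"
    using assms append_butlast_last_id[of u] by (metis append.assoc append_Cons append_Nil list.collapse)
  then show ?thesis by (metis sublist_appendI)
qed

text \<open>The factors aaa and aba supply aa, ab and ba; only bb has to be found in
  \<open>y\<close>. Thus two test words show all products f(c) f(d).\<close>

lemma letter_pair_factors:
  assumes "factor_of_inf [ltr_a, ltr_a, ltr_a] x" "factor_of_inf [ltr_a, ltr_b, ltr_a] x"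
    "factor_of_inf [ltr_b, ltr_b, ltr_b] y"
  shows "factor_of_inf [c, d] x \<or> factor_of_inf [c, d] y"
proof (cases c; cases d)
qed (use assms factor_sublist[of "[_, _, _]" _ "[c, d]"] in \<open>auto simp: sublist_Cons_right\<close>)

lemma descent_a:
  assumes S: "test_set S" and f: "preserves_sturmian S f"
    and nbb: "\<And>c d. \<not> sublist [ltr_b, ltr_b] (f [c] @ f [d])"
  shows "\<exists>s\<in>{mor_La, mor_Ra}. \<exists>g. preserves_sturmian S g \<and> image_length g < image_length f \<and> f = s \<circ> g"
proof -
  have ne: "nonerasing f" using f by (simp add: preserves_sturmian_def)
  have nn: "f [c] \<noteq> []" for c using ne by (simp add: nonerasing_def)
  have nb: "\<not> sublist [ltr_b, ltr_b] (f [c])" for c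
    using nbb[of c c] by (meson sublist_append_leftI sublist_order.order_trans sublist_append_rightI)
  \<comment> \<open>An image ending with b and an image starting with b would meet in bb.\<close>
  have "(\<forall>c. hd (f [c]) = ltr_a) \<or> (\<forall>c. last (f [c]) = ltr_a)"
  proof (rule ccontr)
    assume "\<not> ?thesis"
    then obtain c d where "hd (f [d]) = ltr_b" "last (f [c]) = ltr_b" by (metis letter.exhaust)
    then show False using sublist_junction[of "f [c]" "f [d]"] nn nbb by metis
  qed
  then have "\<exists>s\<in>{mor_La, mor_Ra}. \<forall>c. \<exists>v. f [c] = s v"
    using La_preimage[OF nb] Ra_preimage[OF nb] by blast
  then obtain s v where s: "s \<in> {mor_La, mor_Ra}" and v: "\<And>c. f [c] = s (v c)" by metis
  define g where "g = morph_of (v ltr_a) (v ltr_b)"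
  have gv: "g [c] = v c" for c by (cases c) (simp_all add: g_def)
  have s0: "s [] = []" using s by auto
  have g: "nonerasing g" unfolding nonerasing_def
    using gv v nn s0 by (metis g_def morphism_morph_of)
  have sn: "nonerasing s" using s by auto
  have fsg: "f = s \<circ> g"
    by (rule morphism_eqI) (use ne g sn in \<open>simp_all add: nonerasing_morphism nonerasing_comp comp_apply gv v\<close>)
  have fw: "ext f w = ext s (ext g w)" for w using fsg ext_comp[OF sn g] by simp
  have st: "sturmian (ext g w)" if w: "w \<in> S" for w
    unfolding sturmian_def
  proof
    have sf: "sturmian (ext f w)" if "w \<in> S" for w using f that by (simp add: preserves_sturmian_def)
    show "\<not> ultimately_periodic (ext g w)"
      using sf[OF w] ultimately_periodic_ext[OF sn] unfolding fw sturmian_def by blast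
    show "balanced (ext g w)"
    proof (cases "s = mor_La")
      case True
      then show ?thesis using sf[OF w] balanced_ext_La_D unfolding fw sturmian_def by blast
    next
      case False
      then have R: "s = mor_Ra" using s by simp
      \<comment> \<open>The image of \<open>c\<close> is the left context that desubstituting R_a
        requires.\<close>
      obtain c where "c ## w \<in> S" using S w by (auto simp: test_set_def)
      then have "balanced (ext mor_Ra (g [c] @- ext g w))"
        using sf[of "c ## w"] g unfolding fw sturmian_def R by (simp add: ext_SCons)
      then show ?thesis using balanced_ext_Ra_D g by (simp add: nonerasing_def)
    qed
  qed
  have len: "length (f [c]) = length (v c) + count_list (v c) ltr_b" for c
    unfolding v using s by (auto simp: count_La length_Ra)
  obtain x where x: "x \<in> S" using S by (auto simp: test_set_def)
  \<comment> \<open>The length drops by the number of b in the images under \<open>g\<close>. If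
    there were none, \<open>g\<close> would send \<open>x\<close> to a a a ..., which is not
    Sturmian.\<close>
  have "image_length g < image_length f"
  proof (rule ccontr)
    assume "\<not> ?thesis"
    then have "count_list (v ltr_a) ltr_b = 0" "count_list (v ltr_b) ltr_b = 0"
      by (auto simp: image_length_def len gv)
    then have "ltr_b \<notin> set (v c)" for c by (cases c) (auto simp: count_list_0_iff)
    then have "ltr_b \<notin> sset (ext g x)"
      using g gv by (auto simp: ext_def nonerasing_def stream.set_map)
    then have all_a: "ext g x !! n = ltr_a" for n by (metis letter.exhaust snth_sset)
    have "ext g x = [ltr_a] @- ext g x"
    proof (rule stream_eqI)
      fix n show "ext g x !! n = ([ltr_a] @- ext g x) !! n"
        unfolding all_a by (cases n) (simp, simp add: all_a)
    qed
    then have "ultimately_periodic (ext g x)" by (rule ultimately_periodicI) simp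
    then show False using st[OF x] by (simp add: sturmian_def)
  qed
  then show ?thesis using s g st fsg by (auto simp: preserves_sturmian_def)
qed

text \<open>\<open>descent_a\<close> for E f gives f = E s g, and E moves past s by exchanging the
  letters in s.\<close>

lemma descent_b:
  assumes S: "test_set S" and f: "preserves_sturmian S f"
    and naa: "\<And>c d. \<not> sublist [ltr_a, ltr_a] (f [c] @ f [d])"
  shows "\<exists>s\<in>{mor_Lb, mor_Rb}. \<exists>g. preserves_sturmian S g \<and> image_length g < image_length f \<and> f = s \<circ> g"
proof -
  have nbb: "\<not> sublist [ltr_b, ltr_b] ((mor_E \<circ> f) [c] @ (mor_E \<circ> f) [d])" for c d
  proof
    assume "sublist [ltr_b, ltr_b] ((mor_E \<circ> f) [c] @ (mor_E \<circ> f) [d])"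
    then obtain p q where "mor_E (f [c] @ f [d]) = p @ [ltr_b, ltr_b] @ q"
      by (auto simp: sublist_def comp_apply morphism_append)
    then have "f [c] @ f [d] = mor_E (p @ [ltr_b, ltr_b] @ q)" by (metis E_E_apply)
    then have "f [c] @ f [d] = mor_E p @ [ltr_a, ltr_a] @ mor_E q"
      by (simp add: morphism_append[of mor_E] generator_Cons(1))
    then show False using naa by (metis sublist_appendI)
  qed
  obtain s g where s: "s \<in> {mor_La, mor_Ra}" and g: "preserves_sturmian S g"
    "image_length g < image_length (mor_E \<circ> f)" "mor_E \<circ> f = s \<circ> g"
    using descent_a[OF S preserves_sturmian_E[OF f] nbb] by blast
  have "f = mor_E \<circ> (s \<circ> g)" using g(3) by (metis E_E comp_assoc id_comp)
  also have "\<dots> = conj_E s \<circ> (mor_E \<circ> g)" by (metis E_comp comp_assoc)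
  finally have "f = conj_E s \<circ> (mor_E \<circ> g)" .
  moreover have "conj_E s \<in> {mor_Lb, mor_Rb}" using s by auto
  moreover have "preserves_sturmian S (mor_E \<circ> g)" "image_length (mor_E \<circ> g) < image_length f"
    using g(1,2) unfolding image_length_E by (simp_all add: preserves_sturmian_E)
  ultimately show ?thesis by blast
qed

section \<open>Alternating words and the mixed cases\<close>

lemma distinct_adj_letters:
  fixes u :: word
  assumes "\<not> sublist [ltr_a, ltr_a] u" "\<not> sublist [ltr_b, ltr_b] u"
  shows "distinct_adj u"
  using assms
proof (induction u rule: induct_list012)
  case (3 x y zs)
  then have "distinct_adj (y # zs)" by (simp add: sublist_Cons_right)
  moreover have "x \<noteq> y" using 3(3,4) by (cases x) (auto simp: sublist_Cons_right)
  ultimately show ?case by simp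
qed simp_all

lemma distinct_adj_determined:
  fixes u v :: word
  assumes "distinct_adj u" "distinct_adj v" "length u = length v" "u \<noteq> [] \<longrightarrow> hd u = hd v"
  shows "u = v"
  using assms
proof (induction u arbitrary: v)
  case (Cons x u)
  then obtain v' where v: "v = x # v'" by (cases v) auto
  have "hd u = hd v'" if "u \<noteq> []"
  proof -
    have "v' \<noteq> []" using that Cons.prems(3) v by auto
    then have "x \<noteq> hd u" "x \<noteq> hd v'" using that Cons.prems(1,2) v by (auto simp: distinct_adj_Cons)
    then show ?thesis by (metis letter.exhaust)
  qed
  then show ?case using Cons.IH[of v'] Cons.prems v by (auto simp: distinct_adj_Cons)
qed simp

text \<open>If \<open>|A| > 1\<close>, the alternating factor of \<open>A B A\<close> starting at its second letter agrees with
  \<open>e A e\<close>, where \<open>e \<noteq> c\<close>, whereas \<open>A A A\<close> contains \<open>c A c\<close>.\<close>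

lemma alternating_image_letter:
  assumes w: "balanced w" "factor_of_inf (A @ A @ A) w" "factor_of_inf (A @ B @ A) w"
    and alt: "distinct_adj (A @ B @ A)"
    and ne: "A \<noteq> []" "B \<noteq> []" and ends: "hd A = c" "last A = c"
  shows "A = [c]"
proof (rule ccontr)
  assume "A \<noteq> [c]"
  then obtain d A' where A: "A = c # d # A'" using ne ends by (cases A; cases "tl A") auto
  have altA: "distinct_adj A" using alt by (simp add: distinct_adj_append_iff)
  then have dc: "d \<noteq> c" by (auto simp: A)
  let ?m = "length A"
  define V where "V = take (?m + 2) (tl (A @ B @ A))"
  have "tl (A @ B @ A) = d # A' @ B @ A" by (simp add: A)
  then have hdV: "hd V = d" by (simp add: V_def)
  \<comment> \<open>Here \<open>A\<close> has at least two letters and \<open>B\<close> at least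
    one, so enough letters remain after the first one is dropped.\<close>
  have lenV: "length V = ?m + 2" using ne(2) by (cases B) (auto simp: V_def A)
  have "distinct_adj (tl (A @ B @ A))" using alt A by (simp add: distinct_adj_Cons)
  then have altV: "distinct_adj V"
    unfolding V_def by (metis append_take_drop_id distinct_adj_append_iff)
  have "V = [d] @ A @ [d]"
  proof (rule distinct_adj_determined)
    show "distinct_adj ([d] @ A @ [d])"
      using altA dc ends ne(1) by (simp add: distinct_adj_append_iff distinct_adj_Cons)
  qed (use altV lenV hdV in simp_all)
  moreover have "sublist V (A @ B @ A)"
    unfolding V_def by (meson sublist_take sublist_tl sublist_order.order_trans)
  ultimately have fV: "factor_of_inf ([d] @ A @ [d]) w" using factor_sublist[OF w(3)] by simp
  have "A @ A @ A = butlast A @ ([c] @ A @ [c]) @ tl A"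
    using ends ne(1) append_butlast_last_id[of A] by (metis append.assoc append_Cons append_Nil list.collapse)
  then have "sublist ([c] @ A @ [c]) (A @ A @ A)" by (metis sublist_appendI)
  then have fU: "factor_of_inf ([c] @ A @ [c]) w" using factor_sublist[OF w(2)] by simp
  \<comment> \<open>The two factors have the same length and differ exactly in their outer letters,
    so their numbers of b differ by two.\<close>
  show False
    using balanced_b_le[OF w(1) fU fV] balanced_b_le[OF w(1) fV fU] dc by (cases c; cases d) auto
qed

lemma distinct_adj_image:
  assumes f: "nonerasing f" and alt: "\<And>c d. distinct_adj (f [c] @ f [d])"
  shows "distinct_adj (f u)"
proof (induction u)
  case Nil then show ?case using f by (simp add: nonerasing_def morphism_Nil)
next
  case (Cons c u)
  have eq: "f (x # v) = f [x] @ f v" for x v using f morphism_Cons unfolding nonerasing_def by blast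
  have nn: "f [x] \<noteq> []" for x using f by (simp add: nonerasing_def)
  have fc: "distinct_adj (f [c])" using alt[of c c] by (simp add: distinct_adj_append_iff)
  show ?case
  proof (cases u)
    case Nil then show ?thesis using fc by simp
  next
    case (Cons d v)
    have "last (f [c]) \<noteq> hd (f [d])" using alt[of c d] nn by (simp add: distinct_adj_append_iff)
    then have "last (f [c]) \<noteq> hd (f u)" using eq[of d v] nn Cons by simp
    then show ?thesis using Cons.IH fc eq[of c u] by (simp add: distinct_adj_append_iff)
  qed
qed

lemma alternating_ultimately_periodic:
  fixes w :: infword
  assumes "\<And>n. w !! n \<noteq> w !! Suc n"
  shows "ultimately_periodic w"
proof -
  have "w !! n = w !! Suc (Suc n)" for n
    using assms[of n] assms[of "Suc n"] by (metis letter.exhaust)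
  then have "w = stl (stl w)" by (intro stream_eqI) simp
  then have "w = [shd w, shd (stl w)] @- w" by (metis shift.simps stream.collapse)
  then show ?thesis by (rule ultimately_periodicI) simp
qed

text \<open>As f(x) avoids bb and f(y) avoids aa, the words shared by both must alternate. The cubes
  \<open>A @ A @ A\<close> and \<open>B @ B @ B\<close> are then compared by balance with
  \<open>A @ B @ A\<close> and \<open>B @ A @ B\<close>.\<close>

lemma mixed_images_id:
  assumes f: "nonerasing f"
    and x: "sturmian (ext f x)" "\<not> factor_of_inf [ltr_b, ltr_b] (ext f x)"
      "factor_of_inf [ltr_a, ltr_a, ltr_a] x" "factor_of_inf [ltr_a, ltr_b, ltr_a] x"
    and y: "sturmian (ext f y)" "\<not> factor_of_inf [ltr_a, ltr_a] (ext f y)"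
      "factor_of_inf [ltr_b, ltr_b, ltr_b] y" "factor_of_inf [ltr_b, ltr_a, ltr_b] y"
  shows "f = id"
proof -
  define A B where "A = f [ltr_a]" and "B = f [ltr_b]"
  have nn: "A \<noteq> []" "B \<noteq> []" using f by (simp_all add: A_def B_def nonerasing_def)
  have f3: "f [c, d, e] = f [c] @ f [d] @ f [e]" for c d e
    using f morphism_append[of f "[c]" "[d, e]"] morphism_append[of f "[d]" "[e]"] by (simp add: nonerasing_def)
  have fx: "factor_of_inf (A @ A @ A) (ext f x)" "factor_of_inf (A @ B @ A) (ext f x)"
    and fy: "factor_of_inf (B @ B @ B) (ext f y)" "factor_of_inf (B @ A @ B) (ext f y)"
    using factor_ext[OF f x(3)] factor_ext[OF f x(4)] factor_ext[OF f y(3)] factor_ext[OF f y(4)]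
    by (simp_all add: f3 A_def B_def)
  have nx: "\<not> sublist [ltr_b, ltr_b] (A @ A @ A)" "\<not> sublist [ltr_b, ltr_b] (A @ B @ A)"
    and ny: "\<not> sublist [ltr_a, ltr_a] (B @ B @ B)" "\<not> sublist [ltr_a, ltr_a] (B @ A @ B)"
    using fx fy x(2) y(2) factor_sublist by blast+
  have sub: "sublist (u @ v) (u @ v @ t)" "sublist (v @ t) (u @ v @ t)" for u v t :: word
    by (metis append.assoc sublist_append_rightI, rule sublist_append_leftI)
  \<comment> \<open>Both products are factors of \<open>A @ B @ A\<close>, which has no bb, and of
    \<open>B @ A @ B\<close>, which has no aa.\<close>
  have AB: "distinct_adj (A @ B)" "distinct_adj (B @ A)"
    using nx(2) ny(2) sub by (metis distinct_adj_letters sublist_order.order_trans)+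
  have d: "distinct_adj A" "distinct_adj B" "last A \<noteq> hd B" "last B \<noteq> hd A"
    using AB nn by (auto simp: distinct_adj_append_iff)
  have AA: "last A \<noteq> ltr_b \<or> hd A \<noteq> ltr_b"
    using sublist_junction[of A A] nx(1) sub(1)[of A A A] nn by (metis sublist_order.order_trans)
  have "hd A = ltr_a" "last A = ltr_a"
  proof -
    have "hd A = last A"
    proof (rule ccontr)
      \<comment> \<open>Then all four junctions of \<open>A\<close> and \<open>B\<close> alternate,
        hence so does the whole image of \<open>x\<close>, which would be periodic.\<close>
      assume ne: "hd A \<noteq> last A"
      have "distinct_adj (f [c] @ f [e])" for c e
      proof -
        have "last B = last A" "hd B = hd A" using ne d by (metis letter.exhaust)+
        then have "last A \<noteq> hd A" "last B \<noteq> hd B" using ne by auto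
        then show ?thesis using d AB by (cases c; cases e) (simp_all add: distinct_adj_append_iff flip: A_def B_def)
      qed
      then have alt: "distinct_adj (f u)" for u using distinct_adj_image[OF f] by blast
      have "ext f x !! n \<noteq> ext f x !! Suc n" for n
      proof -
        let ?u = "f (stake (Suc (Suc n)) x)"
        have l: "Suc n < length ?u"
          using nonerasing_length[OF f, of "stake (Suc (Suc n)) x"] by (simp del: stake.simps)
        have "ext f x = ?u @- ext f (sdrop (Suc (Suc n)) x)" by (rule ext_split[OF f])
        then have "ext f x !! n = ?u ! n" "ext f x !! Suc n = ?u ! Suc n"
          using l by (metis Suc_lessD shift_snth_less)+
        then show ?thesis using alt[of "stake (Suc (Suc n)) x"] l by (simp add: distinct_adj_conv_nth)
      qed
      then show False using x(1) alternating_ultimately_periodic by (auto simp: sturmian_def)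
    qed
    then show "hd A = ltr_a" "last A = ltr_a" using AA by (metis letter.exhaust)+
  qed
  then have B: "hd B = ltr_b" "last B = ltr_b" using d by (metis letter.exhaust)+
  have ABA: "distinct_adj (A @ B @ A)" "distinct_adj (B @ A @ B)"
    using d nn by (simp_all add: distinct_adj_append_iff)
  have "A = [ltr_a]"
    using alternating_image_letter[OF _ fx ABA(1) nn] x(1) \<open>hd A = ltr_a\<close> \<open>last A = ltr_a\<close>
    by (simp add: sturmian_def)
  moreover have "B = [ltr_b]"
    using alternating_image_letter[OF _ fy ABA(2) nn(2,1) B] y(1) by (simp add: sturmian_def)
  ultimately show ?thesis
    using f by (intro morphism_eqI) (simp_all add: nonerasing_morphism A_def B_def id_apply)
qed

lemma sturmian_descent:
  assumes S: "test_set S" and f: "preserves_sturmian S f" and "f \<noteq> id" "f \<noteq> mor_E"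
  shows "\<exists>s\<in>{mor_La, mor_Lb, mor_Ra, mor_Rb}. \<exists>g. preserves_sturmian S g \<and>
    image_length g < image_length f \<and> f = s \<circ> g"
proof -
  have ne: "nonerasing f" using f by (simp add: preserves_sturmian_def)
  obtain x where x: "x \<in> S" "factor_of_inf [ltr_a, ltr_a, ltr_a] x" "factor_of_inf [ltr_a, ltr_b, ltr_a] x"
    using S by (auto simp: test_set_def)
  obtain y where y: "y \<in> S" "factor_of_inf [ltr_b, ltr_b, ltr_b] y" "factor_of_inf [ltr_b, ltr_a, ltr_b] y"
    using S by (auto simp: test_set_def)
  have st: "sturmian (ext f x)" "sturmian (ext f y)" using f x y by (simp_all add: preserves_sturmian_def)
  have pair: "factor_of_inf (f [c] @ f [d]) (ext f x) \<or> factor_of_inf (f [c] @ f [d]) (ext f y)" for c d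
    using letter_pair_factors[OF x(2,3) y(2), of c d]
      factor_ext[OF ne, of "[c, d]" x] factor_ext[OF ne, of "[c, d]" y]
      morphism_append[OF nonerasing_morphism[OF ne], of "[c]" "[d]"] by auto
  have dich: "\<not> factor_of_inf [ltr_a, ltr_a] w \<or> \<not> factor_of_inf [ltr_b, ltr_b] w" if "sturmian w" for w
    using that balanced_not_aa_bb by (auto simp: sturmian_def)
  \<comment> \<open>Each of the two test images is balanced and so avoids aa or bb. If both avoid
    the same square, every product f(c) f(d) avoids it.\<close>
  consider (bb) "\<not> factor_of_inf [ltr_b, ltr_b] (ext f x)" "\<not> factor_of_inf [ltr_b, ltr_b] (ext f y)"
    | (aa) "\<not> factor_of_inf [ltr_a, ltr_a] (ext f x)" "\<not> factor_of_inf [ltr_a, ltr_a] (ext f y)"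
    | (ba) "\<not> factor_of_inf [ltr_b, ltr_b] (ext f x)" "\<not> factor_of_inf [ltr_a, ltr_a] (ext f y)"
    | (ab) "\<not> factor_of_inf [ltr_a, ltr_a] (ext f x)" "\<not> factor_of_inf [ltr_b, ltr_b] (ext f y)"
    using dich[OF st(1)] dich[OF st(2)] by blast
  then show ?thesis
  proof cases
    case bb
    then show ?thesis using descent_a[OF S f] pair factor_sublist by blast
  next
    case aa
    then show ?thesis using descent_b[OF S f] pair factor_sublist by blast
  next
    case ba
    then show ?thesis using mixed_images_id[OF ne st(1) _ x(2,3) st(2) _ y(2,3)] assms(3) by blast
  next
    case ab
    \<comment> \<open>Composing with E turns this case into the preceding one.\<close>
    have ne': "nonerasing (mor_E \<circ> f)" using ne by (simp add: nonerasing_comp)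
    have ext: "ext (mor_E \<circ> f) w = ext mor_E (ext f w)" for w using ne by (simp add: ext_comp)
    have "\<not> factor_of_inf [ltr_b, ltr_b] (ext (mor_E \<circ> f) x)" "\<not> factor_of_inf [ltr_a, ltr_a] (ext (mor_E \<circ> f) y)"
      using ab factor_E[of "[_, _]"] unfolding ext by (force simp: generator_Cons)+
    then have "mor_E \<circ> f = id"
      using mixed_images_id[OF ne' _ _ x(2,3) _ _ y(2,3)] st by (simp add: ext sturmian_ext_E)
    then have "f = mor_E" by (metis E_E comp_assoc comp_id id_comp)
    then show ?thesis using assms(4) by simp
  qed
qed

text \<open>Generators are removed on the left, so an exchange E left at the end of the descent
  stays on the right, recorded by \<open>e\<close>. Strong quasiperiodicity, once reached, survives
  every further generator.\<close>

lemma sturmian_cases: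
  assumes S: "test_set S" and "preserves_sturmian S f"
  shows "strongly_quasiperiodic f \<or> (\<exists>e\<in>{mor_E, id}. f \<circ> e \<in> a_type \<union> b_type)"
  using assms(2)
proof (induction f rule: measure_induct_rule[of image_length])
  case (less f)
  show ?case
  proof (cases "f = id \<or> f = mor_E")
    case True
    then have "\<exists>e\<in>{mor_E, id}. f \<circ> e = id" using E_E by auto
    then show ?thesis using id_a_type by fastforce
  next
    case False
    then obtain s g where s: "s \<in> {mor_La, mor_Lb, mor_Ra, mor_Rb}" and g: "preserves_sturmian S g"
      "image_length g < image_length f" "f = s \<circ> g"
      using sturmian_descent[OF S less.prems] by blast
    have "nonerasing s" using s by auto
    from less.IH[OF g(2,1)] show ?thesis
    proof (elim disjE bexE)
      assume "strongly_quasiperiodic g"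
      then show ?thesis using g(3) \<open>nonerasing s\<close> strongly_quasiperiodic_comp_left by blast
    next
      fix e assume e: "e \<in> {mor_E, id}" "g \<circ> e \<in> a_type \<union> b_type"
      have fe: "f \<circ> e = s \<circ> (g \<circ> e)" by (simp add: g(3) comp_assoc)
      from generator_comp[OF e(2) s] show ?thesis unfolding fe[symmetric]
      proof
        assume "strongly_quasiperiodic (f \<circ> e)"
        then have "strongly_quasiperiodic (f \<circ> e \<circ> e)"
          using e(1) by (elim strongly_quasiperiodic_comp_right) auto
        moreover have "f \<circ> e \<circ> e = f" using e(1) E_E by (auto simp: comp_assoc)
        ultimately show ?thesis by simp
      qed (use e(1) in blast)
    qed
  qed
qed

text \<open>If one letter is erased, all images are powers of the image of the other letter, so the
  image of \<open>w\<close> would be periodic. The given Sturmian word keeps the hypothesis on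
  \<open>f\<close> from being vacuous.\<close>

lemma sturmian_morphism_nonerasing:
  assumes f: "sturmian_morphism f" and w: "sturmian w"
  shows "nonerasing f"
proof (rule ccontr)
  have m: "morphism f" using f by (simp add: sturmian_morphism_def)
  assume "\<not> nonerasing f"
  then obtain c where c: "f [c] = []" using m by (auto simp: nonerasing_def)
  define d where "d = (if c = ltr_a then ltr_b else ltr_a)"
  have other: "x = c \<or> x = d" for x by (cases x; cases c) (auto simp: d_def)
  have dc: "d \<noteq> c" by (simp add: d_def)
  have img: "f u = concat (replicate (count_list u d) (f [d]))" for u
  proof (induction u)
    case Nil then show ?case using m by (simp add: morphism_Nil)
  next
    case (Cons x u)
    have "f (x # u) = f [x] @ f u" using m by (rule morphism_Cons)
    then show ?case using Cons other[of x] c dc by auto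
  qed
  obtain v where v: "inf_image f w v" "sturmian v" using f w by (auto simp: sturmian_morphism_def)
  have nd: "f [d] \<noteq> []"
  proof
    assume "f [d] = []"
    then have "f u = []" for u using img[of u] by (simp add: concat_replicate_trivial)
    then show False using v(1) unfolding inf_image_def by (metis le_zero_eq list.size(3) nat.distinct(1))
  qed
  have cyc: "cycle (f [d]) = concat (replicate k (f [d])) @- cycle (f [d])" for k
    by (induction k) (simp_all, metis cycle_decomp nd)
  have "v = cycle (f [d])"
  proof (rule stream_eq_stakeI)
    fix n
    obtain k where k: "n \<le> length (f (stake k w))" "prefix_of_inf (f (stake k w)) v"
      using v(1) unfolding inf_image_def by blast
    then obtain t where "v = f (stake k w) @- t" by (auto simp: prefix_of_inf_iff)
    moreover have "cycle (f [d]) = f (stake k w) @- cycle (f [d])" using cyc img by metis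
    ultimately show "stake n v = stake n (cycle (f [d]))"
      using shift_eq_stake k(1) by metis
  qed
  then have "v = [] @- cycle (f [d])" by simp
  then show False using v(2) nd unfolding sturmian_def ultimately_periodic_def by blast
qed

theorem proposition7p3:
  fixes f :: "word \<Rightarrow> word"
  assumes "sturmian_morphism f" and "f \<noteq> mor_E" and "f \<noteq> id"
  shows "weakly_quasiperiodic f \<longleftrightarrow>
    f \<in> {mor_E, id} \<odot> comp_star {mor_La, mor_Rb} \<odot> comp_star {mor_La, mor_Ra}
      \<union> {mor_E, id} \<odot> comp_star {mor_Lb, mor_Ra} \<odot> comp_star {mor_Lb, mor_Rb}"
proof -
  have T: "f \<in> {mor_E, id} \<odot> comp_star {mor_La, mor_Rb} \<odot> comp_star {mor_La, mor_Ra}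
      \<union> {mor_E, id} \<odot> comp_star {mor_Lb, mor_Ra} \<odot> comp_star {mor_Lb, mor_Rb} \<longleftrightarrow>
      (\<exists>e\<in>{mor_E, id}. \<exists>g\<in>a_type \<union> b_type. f = e \<circ> g)"
    unfolding comp_set_assoc Un_iff comp_set_iff[of f "{mor_E, id}"] by blast
  obtain S where S: "test_set S" using test_set_exists by blast
  then obtain x where x: "sturmian x" by (auto simp: test_set_def)
  have ne: "nonerasing f" using sturmian_morphism_nonerasing[OF assms(1) x] .
  have "preserves_sturmian S f"
    unfolding preserves_sturmian_def
    using ne S assms(1) by (auto simp: test_set_def sturmian_morphism_def inf_image_ext)
  note cases = sturmian_cases[OF S this]
  show ?thesis unfolding T
  proof
    assume "weakly_quasiperiodic f"
    then have "\<not> strongly_quasiperiodic f"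
      using ne by (auto simp: strongly_quasiperiodic_def weakly_quasiperiodic_iff)
    then obtain e where e: "e \<in> {mor_E, id}" "f \<circ> e \<in> a_type \<union> b_type" using cases by blast
    show "\<exists>e\<in>{mor_E, id}. \<exists>g\<in>a_type \<union> b_type. f = e \<circ> g"
    proof (cases "e = id")
      case True then show ?thesis using e by (metis comp_id id_comp insertCI)
    next
      case False
      then have "f \<circ> mor_E \<in> a_type \<union> b_type" using e by auto
      \<comment> \<open>The descent leaves E on the right, the theorem has it on the left;
        conjugation carries it across and swaps the two kinds.\<close>
      then have "conj_E (f \<circ> mor_E) \<in> a_type \<union> b_type" using conj_E_a_type conj_E_b_type by blast
      moreover have "f = mor_E \<circ> conj_E (f \<circ> mor_E)"
        by (simp add: conj_E_def fun_eq_iff comp_apply)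
      ultimately show ?thesis by blast
    qed
  next
    assume "\<exists>e\<in>{mor_E, id}. \<exists>g\<in>a_type \<union> b_type. f = e \<circ> g"
    then obtain e g where e: "e \<in> {mor_E, id}" and g: "g \<in> a_type \<union> b_type" and f: "f = e \<circ> g" by blast
    have "g \<noteq> id" using e f assms by auto
    then have "weakly_quasiperiodic g" "nonerasing g"
      using g weakly_quasiperiodic_a_type weakly_quasiperiodic_b_type nonerasing_a_type nonerasing_b_type
      by blast+
    then show "weakly_quasiperiodic f" using e f by (auto simp: weakly_quasiperiodic_E_comp)
  qed
qed

end
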